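(* Let $n$ replicas $R1,\dots,Rn$ form a fully replicated, eventually consistent transactional database as described in the context, and consider one invocation of the algorithm MuFASA (described in the context) with initiator $R1$. Let $CP$ be the checkpoint it records and $CP_{set}$ the set of transactions whose effects are reflected in $CP$. Then $CP$ is a distributed transaction-consistent snapshot (DTCS), that is: (1) Dirty Write Exclusion: $CP$ is the state of the database after the execution of the transactions in $CP_{set}$, all of which are committed transactions; no writes of uncommitted transactions are included. (2) Dependency Closure: if $T\in CP_{set}$ was issued at replica $Ri$, and some transaction $U$ (issued at any replica) was committed at $Ri$ before $T$ was committed at $Ri$, then $U\in CP_{set}$. Moreover, MuFASA satisfies: (3) Recency: every transaction that has been committed at $R1$ at the time of the invocation belongs to $CP_{set}$. (4) Strict Concision: the information stored as the checkpoint contains only one copy of each object of the database. (5) Asynchronous behavior: MuFASA adds only a finite number of steps to the execution of each transaction and to the sending and receiving of each update message, none of which waits for the checkpointing thread, and its control messages do not block update messages. (6) Bounded message complexity: the number of additional (control) messages sent is bounded by $2n-2$, independently of the number of objects in the database and of the number of transactions.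
   Context: **System.** There are $n$ replicas $R1,\dots,Rn$, each holding a copy of every object. Replicas communicate over pairwise unidirectional non-FIFO channels that eventually deliver every message; separate non-FIFO channels of the same kind are used for control messages. A client issues a transaction $T$ (reading/writing several objects) at a single replica $Ri$. Each replica uses two-phase locking, so transactions performed at a replica are strictly serializable, ordered by their commit times there. Committing a transaction appends an entry to the replica's commit-log. A single MessageSender thread at $Ri$ reads the commit-log in order and, for each entry of a transaction issued at $Ri$, sends to all other replicas an update message containing the updates of that transaction. At each other replica $Rj$ a MessageReceiver thread (one per incoming channel) receives it and executes and commits the transaction at $Rj$, appending it to $Rj$'s commit-log. Different replicas may commit transactions in different orders; a conflict-resolution mechanism guarantees that the database state resulting from a given set of transactions does not depend on the order in which they are performed. **Colors.** Each replica has a linearizable shared variable RColor with values Green, Yellow, Red, initially Green. Every update message carries a color (two bits). **Initiator $R1$.** On invocation, $R1$ sets RColor to Yellow, later sets it to Red, and records a local checkpoint of its own state with a non-blocking copy-on-write procedure (CALC), which is used as a black box with the following guarantees: it never blocks transactions (it adds to each transaction at $R1$ a number of steps of the order of the number of keys of the transaction); it stores one value per object; the recorded state is the result of exactly those transactions committed at $R1$ before the switch of RColor from Yellow to Red (the local cut of $R1$), hence of a prefix of the transactions committed at $R1$ that includes all those committed before the invocation, and it contains no uncommitted writes. $R1$'s MessageSender reads RColor before sending each update message and colors the message Red if RColor is Red and Green otherwise. When $R1$ receives an update message that is not Red and whose transaction commits at $R1$ after $R1$ became Red, it also executes this transaction on the stored checkpoint. $R1$ counts, per sender, the Green and Yellow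 update messages received, incrementing the counter for a message only after it has executed the message's transaction at $R1$ and, in the case where the transaction commits at $R1$ after $R1$ became Red, has also executed it on the stored checkpoint. After becoming Red and recording its local checkpoint, $R1$ sends a control message CPRequest to each other replica, waits for a control reply CPReply$(c_i)$ from each $Ri$, $i\ne1$, and then waits until, for every $i\neq 1$, its counter of Green and Yellow messages received from $Ri$ equals $c_i$; then it terminates, and the stored checkpoint is the final checkpoint $CP$. Thus $CP_{set}$ consists of the transactions recorded by the local checkpoint and those executed afterwards on the checkpoint. **Non-initiator $Ri$, $i\neq1$.** - On receiving CPRequest: compare-and-swap (CAS) RColor from Green to Yellow, and append a special entry CpLog to the commit-log. - Each MessageReceiver thread has a thread-local boolean appendSuccess, initially false. On receiving an update message $M$: if RColor is Green and $M$ is not Green, it performs CAS on RColor from Green to Yellow, appends CpLog to the commit-log, and sets appendSuccess to true; otherwise, if RColor is Yellow and appendSuccess is false, it appends CpLog and sets appendSuccess to true. After this it executes the transaction of $M$. - The MessageSender has a local variable currColor, initially Green, and a message counter, initially $0$. It repeatedly reads the next commit-log entry. If the entry is a locally issued transaction: if currColor differs from RColor and RColor is Yellow, it appends CpLog to the commit-log and sets currColor to RColor; then it colors the update message with currColor, increments the counter, and sends the message to all other replicas. If the entry is CpLog and RColor is not Red: it sets RColor and currColor to Red and sends CPReply(counter) to $R1$ over the control channel. All later CpLog entries are ignored. *)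

theory Defs
  imports "HOL-Library.Multiset"
begin

section \<open>Fully replicated databases\<close>

text \<open>
  Replicas are the numbers \<open>1..n\<close>; the initiator is replica \<open>1\<close>.
  An element of the type \<open>'tx\<close> is one concrete transaction together with the updates that its
  update message carries: \<open>apply_tx T\<close> is the effect of performing these updates on a database
  state, \<open>keys T\<close> is the set of objects read or written, and \<open>origin T\<close> is the replica at which
  \<open>T\<close> is issued (if it is issued at all).  The finite type \<open>'obj\<close> is the set of objects.
  The number \<open>calc_const\<close> is the constant in the guarantee of the copy-on-write procedure
  (CALC) that it adds to a transaction a number of steps of the order of its number of keys.
\<close>

type_synonym replica = nat

type_synonym ('obj, 'val) database = "'obj \<Rightarrow> 'val"

record ('tx, 'obj, 'val) system =
  nrep :: nat
  origin :: "'tx \<Rightarrow> replica"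
  keys :: "'tx \<Rightarrow> 'obj set"
  apply_tx :: "'tx \<Rightarrow> ('obj, 'val) database \<Rightarrow> ('obj, 'val) database"
  db0 :: "('obj, 'val) database"
  calc_const :: nat

definition replicas :: "('tx, 'obj, 'val) system \<Rightarrow> replica set" where
  "replicas Sys = {1..nrep Sys}"

definition db_after :: "('tx, 'obj, 'val) system \<Rightarrow> 'tx list \<Rightarrow> ('obj, 'val) database" where
  "db_after Sys xs = fold (apply_tx Sys) xs (db0 Sys)"

text \<open>The last conjunct is the guarantee of the conflict-resolution mechanism.\<close>

definition replicated_database :: "('tx, 'obj, 'val) system \<Rightarrow> bool" where
  "replicated_database Sys \<longleftrightarrow>
     nrep Sys \<ge> 1 \<and>
     (\<forall>T d x. x \<notin> keys Sys T \<longrightarrow> apply_tx Sys T d x = d x) \<and>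
     (\<forall>xs ys. distinct xs \<and> distinct ys \<and> set xs = set ys \<longrightarrow> db_after Sys xs = db_after Sys ys)"

section \<open>States\<close>

datatype color = Green | Yellow | Red

datatype 'tx entry = Tx 'tx | CpLog

text \<open>
  Program counters of the threads.  An argument \<open>'tx\<close> is the transaction being processed, an
  argument \<open>color\<close> the color of its update message.
\<close>

datatype 'tx sender_pc =
    SIdle
  | SRead 'tx          \<comment> \<open>about to read RColor\<close>
  | SAppend 'tx        \<comment> \<open>about to append CpLog and to update currColor\<close>
  | SColor 'tx         \<comment> \<open>about to color the message and to count it\<close>
  | SSend 'tx color    \<comment> \<open>about to send\<close>
  | SCp                \<comment> \<open>has read a CpLog entry\<close>
  | SSetRed
  | SReply

datatype 'tx receiver_pc =
    RIdle
  | RTest1 'tx color   \<comment> \<open>is RColor Green and the message not Green?\<close>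
  | RCas 'tx color
  | RTest2 'tx color   \<comment> \<open>is RColor Yellow and appendSuccess false?\<close>
  | RAppend 'tx color
  | RExec 'tx color    \<comment> \<open>executing the transaction\<close>
  | RCkpt 'tx color    \<comment> \<open>at the initiator: about to execute it on the stored checkpoint\<close>
  | RCount 'tx color   \<comment> \<open>at the initiator: about to increment the counter of the sender\<close>

datatype control_pc = CIdle | CCas | CAppend

datatype checkpoint_pc =
    KIdle
  | KYellow
  | KRecord
  | KRequest "replica set"   \<comment> \<open>destinations to which CPRequest is still to be sent\<close>
  | KReplies
  | KCounters
  | KDone

text \<open>
  Two-phase locking enters only through its guarantee: a transaction takes effect atomically at its
  commit, so \<open>db i\<close>, the committed state of replica \<open>i\<close>, evolves in the order of the commit-log.
  Before its commit, a transaction may have written arbitrary values, kept in \<open>uncommitted\<close>.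
  Channels are multisets of the messages in transit, which makes them non-FIFO:
  \<open>chan (j, i)\<close> leads from \<open>j\<close> to \<open>i\<close>.  The index \<open>(i, j)\<close> in \<open>rpc\<close> and \<open>append_success\<close>
  denotes the MessageReceiver at \<open>i\<close> for the channel from \<open>j\<close>.

  The stored checkpoint \<open>store\<close> is a multiset of copies of objects.  Its content is defined by the
  guarantee of CALC: \<open>base\<close> is the committed state of the initiator, and \<open>cut\<close> the set of
  transactions committed there, when RColor is switched to Red; an object without a stored copy has
  its value in \<open>base\<close>, and copies are made lazily.  The transactions executed afterwards on the
  stored checkpoint are collected in \<open>cp_exec\<close>.  (\<open>base\<close>, \<open>cut\<close> and \<open>cp_exec\<close> are not part of
  the information stored by the algorithm.)
\<close>

record ('tx, 'obj, 'val) state =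
  issued :: "'tx set"
  client :: "replica \<Rightarrow> 'tx set"            \<comment> \<open>locally issued, neither committed nor aborted\<close>
  uncommitted :: "replica \<times> 'tx \<Rightarrow> 'obj \<Rightarrow> 'val option"
  db :: "replica \<Rightarrow> ('obj, 'val) database"
  clog :: "replica \<Rightarrow> 'tx entry list"
  chan :: "replica \<times> replica \<Rightarrow> ('tx \<times> color) multiset"
  rcolor :: "replica \<Rightarrow> color"
  spc :: "replica \<Rightarrow> 'tx sender_pc"
  log_pos :: "replica \<Rightarrow> nat"               \<comment> \<open>number of log entries read by the MessageSender\<close>
  curr_color :: "replica \<Rightarrow> color"
  sent_count :: "replica \<Rightarrow> nat"
  rpc :: "replica \<times> replica \<Rightarrow> 'tx receiver_pc"
  append_success :: "replica \<times> replica \<Rightarrow> bool"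
  cpc :: "replica \<Rightarrow> control_pc"
  kpc :: checkpoint_pc
  base :: "('obj, 'val) database"
  cut :: "'tx set"
  cp_exec :: "'tx set"
  store :: "('obj \<times> 'val) multiset"
  recv_count :: "replica \<Rightarrow> nat"            \<comment> \<open>counters of the initiator, per sender\<close>
  replies :: "replica \<Rightarrow> nat option"
  request_chan :: "replica \<Rightarrow> nat"          \<comment> \<open>number of CPRequests in transit to a replica\<close>
  reply_chan :: "replica \<Rightarrow> nat multiset"   \<comment> \<open>CPReplies in transit from a replica\<close>
  calc_used :: "'tx \<Rightarrow> nat"                 \<comment> \<open>CALC steps performed by a transaction\<close>

definition init_state :: "('tx, 'obj, 'val) system \<Rightarrow> ('tx, 'obj, 'val) state" where
  "init_state Sys = \<lparr>
     issued = {}, client = (\<lambda>_. {}), uncommitted = (\<lambda>_. Map.empty), db = (\<lambda>_. db0 Sys),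
     clog = (\<lambda>_. []), chan = (\<lambda>_. {#}), rcolor = (\<lambda>_. Green),
     spc = (\<lambda>_. SIdle), log_pos = (\<lambda>_. 0), curr_color = (\<lambda>_. Green), sent_count = (\<lambda>_. 0),
     rpc = (\<lambda>_. RIdle), append_success = (\<lambda>_. False), cpc = (\<lambda>_. CIdle), kpc = KIdle,
     base = db0 Sys, cut = {}, cp_exec = {}, store = {#}, recv_count = (\<lambda>_. 0),
     replies = Map.empty, request_chan = (\<lambda>_. 0), reply_chan = (\<lambda>_. {#}), calc_used = (\<lambda>_. 0) \<rparr>"

definition executing :: "('tx, 'obj, 'val) state \<Rightarrow> replica \<Rightarrow> 'tx \<Rightarrow> bool" where
  "executing s i T \<longleftrightarrow> T \<in> client s i \<or> (\<exists>j c. rpc s (i, j) = RExec T c)"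

definition committed_at :: "('tx, 'obj, 'val) state \<Rightarrow> replica \<Rightarrow> 'tx set" where
  "committed_at s i = {T. Tx T \<in> set (clog s i)}"

definition committed_before :: "('tx, 'obj, 'val) state \<Rightarrow> replica \<Rightarrow> 'tx \<Rightarrow> 'tx \<Rightarrow> bool" where
  "committed_before s i U T \<longleftrightarrow>
     (\<exists>p q. p < q \<and> q < length (clog s i) \<and> clog s i ! p = Tx U \<and> clog s i ! q = Tx T)"

section \<open>Effects of steps\<close>

definition commit ::
  "('tx, 'obj, 'val) system \<Rightarrow> replica \<Rightarrow> 'tx \<Rightarrow> ('tx, 'obj, 'val) state \<Rightarrow> ('tx, 'obj, 'val) state" where
  "commit Sys i T s = s\<lparr>
     db := (db s)(i := apply_tx Sys T (db s i)),
     clog := (clog s)(i := clog s i @ [Tx T]),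
     uncommitted := (uncommitted s)((i, T) := Map.empty) \<rparr>"

definition append_cplog ::
  "replica \<Rightarrow> ('tx, 'obj, 'val) state \<Rightarrow> ('tx, 'obj, 'val) state" where
  "append_cplog i s = s\<lparr> clog := (clog s)(i := clog s i @ [CpLog]) \<rparr>"

definition cas_green_yellow ::
  "replica \<Rightarrow> ('tx, 'obj, 'val) state \<Rightarrow> ('tx, 'obj, 'val) state" where
  "cas_green_yellow i s = (if rcolor s i = Green then s\<lparr> rcolor := (rcolor s)(i := Yellow) \<rparr> else s)"

definition stored :: "('tx, 'obj, 'val) state \<Rightarrow> 'obj \<Rightarrow> bool" where
  "stored s x \<longleftrightarrow> (\<exists>v. (x, v) \<in># store s)"

definition checkpoint_view :: "('tx, 'obj, 'val) state \<Rightarrow> ('obj, 'val) database" where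
  "checkpoint_view s x = (if stored s x then (THE v. (x, v) \<in># store s) else base s x)"

definition copy_object :: "'obj \<Rightarrow> ('tx, 'obj, 'val) state \<Rightarrow> ('tx, 'obj, 'val) state" where
  "copy_object x s = (if stored s x then s else s\<lparr> store := add_mset (x, base s x) (store s) \<rparr>)"

definition exec_on_checkpoint ::
  "('tx, 'obj, 'val) system \<Rightarrow> 'tx \<Rightarrow> ('tx, 'obj, 'val) state \<Rightarrow> ('tx, 'obj, 'val) state" where
  "exec_on_checkpoint Sys T s = s\<lparr>
     store := filter_mset (\<lambda>(x, v). x \<notin> keys Sys T) (store s) +
              image_mset (\<lambda>x. (x, apply_tx Sys T (checkpoint_view s) x)) (mset_set (keys Sys T)),
     cp_exec := insert T (cp_exec s) \<rparr>"

section \<open>The transition system\<close>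

text \<open>
  Arguments of actions: the replica at which the thread runs, for a MessageReceiver also the replica
  at the other end of its channel, and the log entry or the transaction being processed.
\<close>

datatype ('tx, 'obj, 'val) action =
  \<comment> \<open>execution of transactions\<close>
    Issue replica 'tx
  | Abort replica 'tx
  | Write replica 'tx 'obj 'val
  | Calc 'tx 'obj
  | CommitLocal replica 'tx
  | CommitRemote replica replica 'tx
  \<comment> \<open>MessageSender\<close>
  | Fetch replica "'tx entry"
  | ReadColor replica 'tx
  | SenderAppend replica 'tx
  | ColorMessage replica 'tx
  | Send replica 'tx
  | TestRed replica
  | SetRed replica
  | SendReply replica
  \<comment> \<open>MessageReceiver\<close>
  | Receive replica replica 'tx
  | Test1 replica replica 'tx
  | Cas replica replica 'tx
  | Test2 replica replica 'tx
  | ReceiverAppend replica replica 'tx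
  | ExecOnCheckpoint replica replica 'tx
  | Count replica replica 'tx
  \<comment> \<open>thread for incoming control messages at a non-initiator\<close>
  | ReceiveRequest replica
  | RequestCas replica
  | RequestAppend replica
  \<comment> \<open>checkpointing thread of the initiator\<close>
  | Invoke
  | BecomeRed
  | CopyObject 'obj
  | Recorded
  | SendRequest replica
  | RequestsSent
  | ReceiveReply replica nat
  | RepliesReceived
  | Finish

inductive step ::
  "('tx, 'obj, 'val) system \<Rightarrow> ('tx, 'obj, 'val) state \<Rightarrow> ('tx, 'obj, 'val) action \<Rightarrow>
   ('tx, 'obj, 'val) state \<Rightarrow> bool"
  for Sys :: "('tx, 'obj, 'val) system" and s :: "('tx, 'obj, 'val) state"
where
  issue: "i \<in> replicas Sys \<Longrightarrow> origin Sys T = i \<Longrightarrow> T \<notin> issued s \<Longrightarrow>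
    step Sys s (Issue i T)
      (s\<lparr> issued := insert T (issued s), client := (client s)(i := insert T (client s i)) \<rparr>)"
| abort: "T \<in> client s i \<Longrightarrow>
    step Sys s (Abort i T)
      (s\<lparr> client := (client s)(i := client s i - {T}),
         uncommitted := (uncommitted s)((i, T) := Map.empty) \<rparr>)"
| "write": "executing s i T \<Longrightarrow> x \<in> keys Sys T \<Longrightarrow>
    step Sys s (Write i T x v)
      (s\<lparr> uncommitted := (uncommitted s)((i, T) := (uncommitted s (i, T))(x \<mapsto> v)) \<rparr>)"
| calc: "executing s 1 T \<Longrightarrow> x \<in> keys Sys T \<Longrightarrow>
    calc_used s T < calc_const Sys * card (keys Sys T) \<Longrightarrow>
    step Sys s (Calc T x)
      ((if rcolor s 1 = Red then copy_object x s else s)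
         \<lparr> calc_used := (calc_used s)(T := Suc (calc_used s T)) \<rparr>)"
| commit_local: "T \<in> client s i \<Longrightarrow>
    step Sys s (CommitLocal i T)
      ((commit Sys i T s)\<lparr> client := (client s)(i := client s i - {T}) \<rparr>)"
| commit_remote: "rpc s (i, j) = RExec T c \<Longrightarrow>
    step Sys s (CommitRemote i j T)
      ((commit Sys i T s)\<lparr> rpc := (rpc s)((i, j) :=
         (if i \<noteq> 1 \<or> c = Red then RIdle
          else if rcolor s 1 = Red then RCkpt T c else RCount T c)) \<rparr>)"

| fetch: "i \<in> replicas Sys \<Longrightarrow> spc s i = SIdle \<Longrightarrow> log_pos s i < length (clog s i) \<Longrightarrow>
    e = clog s i ! log_pos s i \<Longrightarrow>
    step Sys s (Fetch i e)
      (s\<lparr> log_pos := (log_pos s)(i := Suc (log_pos s i)),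
         spc := (spc s)(i := (case e of CpLog \<Rightarrow> SCp
                                      | Tx T \<Rightarrow> if origin Sys T = i then SRead T else SIdle)) \<rparr>)"
| read_color: "spc s i = SRead T \<Longrightarrow>
    step Sys s (ReadColor i T)
      (s\<lparr> spc := (spc s)(i :=
         (if i = 1 then SSend T (if rcolor s i = Red then Red else Green)
          else if curr_color s i \<noteq> rcolor s i \<and> rcolor s i = Yellow then SAppend T
          else SColor T)) \<rparr>)"
| sender_append: "spc s i = SAppend T \<Longrightarrow>
    step Sys s (SenderAppend i T)
      ((append_cplog i s)\<lparr> curr_color := (curr_color s)(i := rcolor s i),
                           spc := (spc s)(i := SColor T) \<rparr>)"
| color_message: "spc s i = SColor T \<Longrightarrow>
    step Sys s (ColorMessage i T)
      (s\<lparr> sent_count := (sent_count s)(i := Suc (sent_count s i)),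
         spc := (spc s)(i := SSend T (curr_color s i)) \<rparr>)"
| send: "spc s i = SSend T c \<Longrightarrow>
    step Sys s (Send i T)
      (s\<lparr> chan := (\<lambda>(k, j). if k = i \<and> j \<in> replicas Sys - {i}
                           then add_mset (T, c) (chan s (k, j)) else chan s (k, j)),
         spc := (spc s)(i := SIdle) \<rparr>)"
| test_red: "spc s i = SCp \<Longrightarrow>
    step Sys s (TestRed i)
      (s\<lparr> spc := (spc s)(i := (if rcolor s i = Red then SIdle else SSetRed)) \<rparr>)"
| set_red: "spc s i = SSetRed \<Longrightarrow>
    step Sys s (SetRed i)
      (s\<lparr> rcolor := (rcolor s)(i := Red), curr_color := (curr_color s)(i := Red),
         spc := (spc s)(i := SReply) \<rparr>)"
| send_reply: "spc s i = SReply \<Longrightarrow>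
    step Sys s (SendReply i)
      (s\<lparr> reply_chan := (reply_chan s)(i := add_mset (sent_count s i) (reply_chan s i)),
         spc := (spc s)(i := SIdle) \<rparr>)"

| receive: "rpc s (i, j) = RIdle \<Longrightarrow> (T, c) \<in># chan s (j, i) \<Longrightarrow>
    step Sys s (Receive i j T)
      (s\<lparr> chan := (chan s)((j, i) := chan s (j, i) - {#(T, c)#}),
         rpc := (rpc s)((i, j) := (if i = 1 then RExec T c else RTest1 T c)) \<rparr>)"
| test1: "rpc s (i, j) = RTest1 T c \<Longrightarrow>
    step Sys s (Test1 i j T)
      (s\<lparr> rpc := (rpc s)((i, j) :=
         (if rcolor s i = Green \<and> c \<noteq> Green then RCas T c else RTest2 T c)) \<rparr>)"
| cas: "rpc s (i, j) = RCas T c \<Longrightarrow>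
    step Sys s (Cas i j T)
      ((cas_green_yellow i s)\<lparr> rpc := (rpc s)((i, j) := RAppend T c) \<rparr>)"
| test2: "rpc s (i, j) = RTest2 T c \<Longrightarrow>
    step Sys s (Test2 i j T)
      (s\<lparr> rpc := (rpc s)((i, j) :=
         (if rcolor s i = Yellow \<and> \<not> append_success s (i, j) then RAppend T c else RExec T c)) \<rparr>)"
| receiver_append: "rpc s (i, j) = RAppend T c \<Longrightarrow>
    step Sys s (ReceiverAppend i j T)
      ((append_cplog i s)\<lparr> append_success := (append_success s)((i, j) := True),
                           rpc := (rpc s)((i, j) := RExec T c) \<rparr>)"
| exec_on_checkpoint: "rpc s (i, j) = RCkpt T c \<Longrightarrow>
    step Sys s (ExecOnCheckpoint i j T)
      ((exec_on_checkpoint Sys T s)\<lparr> rpc := (rpc s)((i, j) := RCount T c) \<rparr>)"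
| count: "rpc s (i, j) = RCount T c \<Longrightarrow>
    step Sys s (Count i j T)
      (s\<lparr> recv_count := (recv_count s)(j := Suc (recv_count s j)),
         rpc := (rpc s)((i, j) := RIdle) \<rparr>)"

| receive_request: "cpc s i = CIdle \<Longrightarrow> request_chan s i > 0 \<Longrightarrow>
    step Sys s (ReceiveRequest i)
      (s\<lparr> request_chan := (request_chan s)(i := request_chan s i - 1),
         cpc := (cpc s)(i := CCas) \<rparr>)"
| request_cas: "cpc s i = CCas \<Longrightarrow>
    step Sys s (RequestCas i) ((cas_green_yellow i s)\<lparr> cpc := (cpc s)(i := CAppend) \<rparr>)"
| request_append: "cpc s i = CAppend \<Longrightarrow>
    step Sys s (RequestAppend i) ((append_cplog i s)\<lparr> cpc := (cpc s)(i := CIdle) \<rparr>)"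

| invoke: "kpc s = KIdle \<Longrightarrow>
    step Sys s Invoke (s\<lparr> rcolor := (rcolor s)(1 := Yellow), kpc := KYellow \<rparr>)"
| become_red: "kpc s = KYellow \<Longrightarrow>
    step Sys s BecomeRed
      (s\<lparr> rcolor := (rcolor s)(1 := Red), base := db s 1, cut := committed_at s 1,
         kpc := KRecord \<rparr>)"
| copy_object: "kpc s = KRecord \<Longrightarrow> step Sys s (CopyObject x) (copy_object x s)"
| recorded: "kpc s = KRecord \<Longrightarrow> (\<And>x. stored s x) \<Longrightarrow>
    step Sys s Recorded (s\<lparr> kpc := KRequest (replicas Sys - {1}) \<rparr>)"
| send_request: "kpc s = KRequest J \<Longrightarrow> j \<in> J \<Longrightarrow>
    step Sys s (SendRequest j)
      (s\<lparr> request_chan := (request_chan s)(j := Suc (request_chan s j)),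
         kpc := KRequest (J - {j}) \<rparr>)"
| requests_sent: "kpc s = KRequest {} \<Longrightarrow> step Sys s RequestsSent (s\<lparr> kpc := KReplies \<rparr>)"
| receive_reply: "kpc s = KReplies \<Longrightarrow> c \<in># reply_chan s i \<Longrightarrow>
    step Sys s (ReceiveReply i c)
      (s\<lparr> reply_chan := (reply_chan s)(i := reply_chan s i - {#c#}),
         replies := (replies s)(i \<mapsto> c) \<rparr>)"
| replies_received: "kpc s = KReplies \<Longrightarrow> (\<And>i. i \<in> replicas Sys - {1} \<Longrightarrow> replies s i \<noteq> None) \<Longrightarrow>
    step Sys s RepliesReceived (s\<lparr> kpc := KCounters \<rparr>)"
| finish: "kpc s = KCounters \<Longrightarrow>
    (\<And>i. i \<in> replicas Sys - {1} \<Longrightarrow> replies s i = Some (recv_count s i)) \<Longrightarrow>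
    step Sys s Finish (s\<lparr> kpc := KDone \<rparr>)"

inductive run ::
  "('tx, 'obj, 'val) system \<Rightarrow> ('tx, 'obj, 'val) state \<Rightarrow> ('tx, 'obj, 'val) action list \<Rightarrow>
   ('tx, 'obj, 'val) state \<Rightarrow> bool"
  for Sys :: "('tx, 'obj, 'val) system" and s :: "('tx, 'obj, 'val) state"
where
  run_Nil: "run Sys s [] s"
| run_snoc: "run Sys s as t \<Longrightarrow> step Sys t a u \<Longrightarrow> run Sys s (as @ [a]) u"

definition finished :: "('tx, 'obj, 'val) state \<Rightarrow> bool" where
  "finished s \<longleftrightarrow> kpc s = KDone"

section \<open>Properties of the recorded checkpoint\<close>

definition cp_set :: "('tx, 'obj, 'val) state \<Rightarrow> 'tx set" where
  "cp_set s = cut s \<union> cp_exec s"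

definition dirty_write_exclusion ::
  "('tx, 'obj, 'val) system \<Rightarrow> ('tx, 'obj, 'val) state \<Rightarrow> bool" where
  "dirty_write_exclusion Sys s \<longleftrightarrow>
     finite (cp_set s) \<and>
     (\<forall>T \<in> cp_set s. T \<in> committed_at s (origin Sys T)) \<and>
     (\<forall>xs. distinct xs \<and> set xs = cp_set s \<longrightarrow>
        (\<forall>x v. (x, v) \<in># store s \<longleftrightarrow> v = db_after Sys xs x))"

definition dependency_closure ::
  "('tx, 'obj, 'val) system \<Rightarrow> ('tx, 'obj, 'val) state \<Rightarrow> bool" where
  "dependency_closure Sys s \<longleftrightarrow>
     (\<forall>T U i. T \<in> cp_set s \<and> origin Sys T = i \<and> committed_before s i U T \<longrightarrow> U \<in> cp_set s)"

definition DTCS :: "('tx, 'obj, 'val) system \<Rightarrow> ('tx, 'obj, 'val) state \<Rightarrow> bool" where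
  "DTCS Sys s \<longleftrightarrow> dirty_write_exclusion Sys s \<and> dependency_closure Sys s"

definition copies :: "('tx, 'obj, 'val) state \<Rightarrow> 'obj \<Rightarrow> nat" where
  "copies s x = size (filter_mset (\<lambda>e. fst e = x) (store s))"

section \<open>Overhead of the algorithm\<close>

text \<open>
  Every action serves one kind of work.  The reading and handling of CpLog entries by the
  MessageSender delays the update messages sent later and is accounted for separately, as
  \<open>Marking\<close>.  \<open>Checkpointing\<close> comprises the checkpointing thread of the initiator and the threads
  for incoming control messages at the other replicas.
\<close>

datatype 'tx work =
    Executing replica 'tx
  | Sending replica 'tx
  | Receiving replica replica 'tx
  | Marking replica
  | Checkpointing

fun work_of :: "('tx, 'obj, 'val) action \<Rightarrow> 'tx work" where
  "work_of (Issue i T) = Executing i T"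
| "work_of (Abort i T) = Executing i T"
| "work_of (Write i T x v) = Executing i T"
| "work_of (Calc T x) = Executing 1 T"
| "work_of (CommitLocal i T) = Executing i T"
| "work_of (CommitRemote i j T) = Executing i T"
| "work_of (Fetch i (Tx T)) = Sending i T"
| "work_of (Fetch i CpLog) = Marking i"
| "work_of (ReadColor i T) = Sending i T"
| "work_of (SenderAppend i T) = Sending i T"
| "work_of (ColorMessage i T) = Sending i T"
| "work_of (Send i T) = Sending i T"
| "work_of (TestRed i) = Marking i"
| "work_of (SetRed i) = Marking i"
| "work_of (SendReply i) = Marking i"
| "work_of (Receive i j T) = Receiving i j T"
| "work_of (Test1 i j T) = Receiving i j T"
| "work_of (Cas i j T) = Receiving i j T"
| "work_of (Test2 i j T) = Receiving i j T"
| "work_of (ReceiverAppend i j T) = Receiving i j T"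
| "work_of (ExecOnCheckpoint i j T) = Receiving i j T"
| "work_of (Count i j T) = Receiving i j T"
| "work_of (ReceiveRequest i) = Checkpointing"
| "work_of (RequestCas i) = Checkpointing"
| "work_of (RequestAppend i) = Checkpointing"
| "work_of Invoke = Checkpointing"
| "work_of BecomeRed = Checkpointing"
| "work_of (CopyObject x) = Checkpointing"
| "work_of Recorded = Checkpointing"
| "work_of (SendRequest i) = Checkpointing"
| "work_of RequestsSent = Checkpointing"
| "work_of (ReceiveReply i c) = Checkpointing"
| "work_of RepliesReceived = Checkpointing"
| "work_of Finish = Checkpointing"

text \<open>The steps of the database itself; all other steps are added by the algorithm.\<close>

fun database_step :: "('tx, 'obj, 'val) action \<Rightarrow> bool" where
  "database_step (Issue i T) = True"
| "database_step (Abort i T) = True"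
| "database_step (Write i T x v) = True"
| "database_step (CommitLocal i T) = True"
| "database_step (CommitRemote i j T) = True"
| "database_step (Fetch i (Tx T)) = True"
| "database_step (Send i T) = True"
| "database_step (Receive i j T) = True"
| "database_step _ = False"

definition added_steps :: "'tx work \<Rightarrow> ('tx, 'obj, 'val) action list \<Rightarrow> nat" where
  "added_steps w as = length (filter (\<lambda>a. \<not> database_step a \<and> work_of a = w) as)"

fun work_size :: "('tx, 'obj, 'val) system \<Rightarrow> 'tx work \<Rightarrow> nat" where
  "work_size Sys (Executing i T) = card (keys Sys T)"
| "work_size Sys _ = 1"

definition enabled ::
  "('tx, 'obj, 'val) system \<Rightarrow> ('tx, 'obj, 'val) state \<Rightarrow> ('tx, 'obj, 'val) action \<Rightarrow> bool" where
  "enabled Sys s a \<longleftrightarrow> (\<exists>t. step Sys s a t)"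

text \<open>
  The thread in charge of some work has an added step of that work as its next step.  (A CALC step
  is never mandatory, see \<open>executions_not_blocked\<close>.)
\<close>

fun at_added_step :: "('tx, 'obj, 'val) state \<Rightarrow> 'tx work \<Rightarrow> bool" where
  "at_added_step s (Executing i T) \<longleftrightarrow> False"
| "at_added_step s (Sending i T) \<longleftrightarrow> spc s i \<in> {SRead T, SAppend T, SColor T}"
| "at_added_step s (Receiving i j T) \<longleftrightarrow>
     (\<exists>c. rpc s (i, j) \<in> {RTest1 T c, RCas T c, RTest2 T c, RAppend T c, RCkpt T c, RCount T c})"
| "at_added_step s (Marking i) \<longleftrightarrow> spc s i \<in> {SCp, SSetRed, SReply}"
| "at_added_step s Checkpointing \<longleftrightarrow> False"

definition finitely_many_added_steps :: "('tx, 'obj, 'val) system \<Rightarrow> bool" where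
  "finitely_many_added_steps Sys \<longleftrightarrow>
     (\<exists>c. \<forall>as s w. run Sys (init_state Sys) as s \<and> w \<noteq> Checkpointing \<longrightarrow>
        added_steps w as \<le> c * work_size Sys w)"

definition added_steps_never_wait :: "('tx, 'obj, 'val) system \<Rightarrow> bool" where
  "added_steps_never_wait Sys \<longleftrightarrow>
     (\<forall>as s w. run Sys (init_state Sys) as s \<and> at_added_step s w \<longrightarrow>
        (\<exists>a. \<not> database_step a \<and> work_of a = w \<and> enabled Sys s a))"

definition executions_not_blocked :: "('tx, 'obj, 'val) system \<Rightarrow> bool" where
  "executions_not_blocked Sys \<longleftrightarrow>
     (\<forall>as s i T. run Sys (init_state Sys) as s \<and> executing s i T \<longrightarrow>
        (\<exists>a t. database_step a \<and> step Sys s a t \<and> T \<in> committed_at t i))"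

text \<open>
  Two states that agree except for what the checkpointing thread of the initiator and the control
  messages have done: the local states of the threads concerned, the control channels, the
  checkpoint, and RColor.
\<close>

definition checkpointing_variant ::
  "('tx, 'obj, 'val) state \<Rightarrow> ('tx, 'obj, 'val) state \<Rightarrow> bool" where
  "checkpointing_variant s s' \<longleftrightarrow>
     (\<exists>rc cp k b cu ce st re rq rp. s' = s\<lparr>
        rcolor := rc, cpc := cp, kpc := k, base := b, cut := cu, cp_exec := ce, store := st,
        replies := re, request_chan := rq, reply_chan := rp \<rparr>)"

definition independent_of_checkpointing :: "('tx, 'obj, 'val) system \<Rightarrow> bool" where
  "independent_of_checkpointing Sys \<longleftrightarrow>
     (\<forall>as s s' a. run Sys (init_state Sys) as s \<and> checkpointing_variant s s' \<and>
        work_of a \<noteq> Checkpointing \<longrightarrow> (enabled Sys s a \<longleftrightarrow> enabled Sys s' a))"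

definition asynchronous :: "('tx, 'obj, 'val) system \<Rightarrow> bool" where
  "asynchronous Sys \<longleftrightarrow>
     finitely_many_added_steps Sys \<and> added_steps_never_wait Sys \<and>
     executions_not_blocked Sys \<and> independent_of_checkpointing Sys"

fun sends_control_message :: "('tx, 'obj, 'val) action \<Rightarrow> bool" where
  "sends_control_message (SendRequest i) = True"
| "sends_control_message (SendReply i) = True"
| "sends_control_message _ = False"

definition control_messages :: "('tx, 'obj, 'val) action list \<Rightarrow> nat" where
  "control_messages as = length (filter sends_control_message as)"

end

theory Submission
  imports Defs
begin

text \<open>
  Since the MessageSender of \<open>Ri\<close>, \<open>i \<noteq> 1\<close>, turns Red when it reads the first CpLog entry, an update
  message of \<open>Ri\<close> is Red iff a CpLog entry precedes its transaction in the commit-log of \<open>Ri\<close>; a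
  message of \<open>R1\<close> that is not Red carries a transaction of the local cut.  Call a transaction early if
  it lies in the local cut (when issued at \<open>R1\<close>), respectively before the first CpLog entry of its
  origin.  A receiver commits the transaction of a message that is not Green only after a CpLog entry
  has been appended, hence every transaction committed at \<open>Ri\<close> before the first CpLog entry is early.
  All transactions in the checkpoint are early, so everything committed before them at their origin is
  early, too.  Finally, the number in the CPReply of \<open>Ri\<close> is the number of early transactions issued
  at \<open>Ri\<close>, and the counter of \<open>R1\<close> is the number of those among them that are executed at \<open>R1\<close> and, if
  necessary, on the checkpoint; when the two agree, the checkpoint contains all of them.
\<close>

section \<open>Transactions and messages\<close>

text \<open>A position in a log can stand for a transaction only because no replica commits a
  transaction twice. Channels are not FIFO, so this is obtained by counting: the copies of a
  transaction on its way to a replica are conserved (\<open>message_tokens\<close>). The color of a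
  message, both counters and dependency closure rely on it.

  Color and earliness agree fully only for senders other than R1: R1 may read RColor after the
  switch and send a transaction of its local cut as Red. One direction suffices there, since R1
  neither replies to itself nor counts messages of its own.

  The two counters are compared as numbers, while the conclusion concerns sets. This works because
  the set counted at R1 is contained in the set counted at the origin.

  Late transactions reach the checkpoint in an order unrelated to any log. The invariant therefore
  asserts only that some repetition-free enumeration of \<open>cp_set\<close> produces the stored
  state; order independence is invoked at the end.

  Control messages and added steps are bounded by potentials, numbers read off the state that change
  with every counted step.\<close>

declare One_nat_def [simp del] \<comment> \<open>keeps the initiator \<open>1\<close> from becoming \<open>Suc 0\<close>\<close>

definition reachable :: "('tx, 'obj, 'val) system \<Rightarrow> ('tx, 'obj, 'val) state \<Rightarrow> bool" where
  "reachable Sys s \<longleftrightarrow> (\<exists>as. run Sys (init_state Sys) as s)"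

lemma reachable_step: "reachable Sys s \<Longrightarrow> step Sys s a t \<Longrightarrow> reachable Sys t"
  unfolding reachable_def by (blast intro: run_snoc)

lemma reachable_induct [consumes 1, case_names init step]:
  assumes "reachable Sys s" and "P (init_state Sys)"
    and "\<And>s a t. reachable Sys s \<Longrightarrow> P s \<Longrightarrow> step Sys s a t \<Longrightarrow> P t"
  shows "P s"
proof -
  obtain as where "run Sys (init_state Sys) as s"
    using assms(1) unfolding reachable_def by blast
  then show ?thesis
    by induction (use assms(2,3) in \<open>auto simp: reachable_def\<close>)
qed

lemmas effect_defs = commit_def append_cplog_def cas_green_yellow_def copy_object_def
  exec_on_checkpoint_def

fun sender_tx :: "'tx sender_pc \<Rightarrow> 'tx option" where
  "sender_tx (SRead T) = Some T"
| "sender_tx (SAppend T) = Some T"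
| "sender_tx (SColor T) = Some T"
| "sender_tx (SSend T c) = Some T"
| "sender_tx _ = None"

fun receiver_msg :: "'tx receiver_pc \<Rightarrow> ('tx \<times> color) option" where
  "receiver_msg RIdle = None"
| "receiver_msg (RTest1 T c) = Some (T, c)"
| "receiver_msg (RCas T c) = Some (T, c)"
| "receiver_msg (RTest2 T c) = Some (T, c)"
| "receiver_msg (RAppend T c) = Some (T, c)"
| "receiver_msg (RExec T c) = Some (T, c)"
| "receiver_msg (RCkpt T c) = Some (T, c)"
| "receiver_msg (RCount T c) = Some (T, c)"

text \<open>The stretch in which R1 has committed a transaction but not yet counted its message; it
  is the correction term of the receive counter.\<close>

fun after_commit :: "'tx receiver_pc \<Rightarrow> bool" where
  "after_commit (RCkpt T c) = True"
| "after_commit (RCount T c) = True"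
| "after_commit _ = False"

definition in_flight :: "('tx, 'obj, 'val) state \<Rightarrow> replica \<Rightarrow> replica \<Rightarrow> 'tx \<Rightarrow> color \<Rightarrow> bool" where
  "in_flight s j i T c \<longleftrightarrow> (T, c) \<in># chan s (j, i) \<or> receiver_msg (rpc s (i, j)) = Some (T, c)"

lemma in_flight_step:
  assumes "step Sys s a t" "in_flight t j i T c"
  shows "in_flight s j i T c \<or> spc s j = SSend T c \<and> i \<noteq> j \<and> i \<in> replicas Sys"
  using assms unfolding in_flight_def
  by cases (((simp add: effect_defs; fail) | auto simp: effect_defs split: if_splits dest: in_diffD)[1])+

lemma in_flight_receiver: "rpc s (i, j) = r \<Longrightarrow> receiver_msg r = Some (T, c) \<Longrightarrow> in_flight s j i T c"
  by (simp add: in_flight_def)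

text \<open>Replaces the case analysis over all actions in invariants about logs: only local
  commits, remote commits and markers append.\<close>

lemma clog_step:
  assumes "step Sys s a t"
  shows "clog t = clog s \<or>
    (\<exists>i e. clog t = (clog s)(i := clog s i @ [e]) \<and>
       ((\<exists>T. e = Tx T \<and> T \<in> client s i) \<or>
        (\<exists>T j c. e = Tx T \<and> rpc s (i, j) = RExec T c) \<or>
        e = CpLog \<and> ((\<exists>T. spc s i = SAppend T) \<or> (\<exists>j T c. rpc s (i, j) = RAppend T c) \<or> cpc s i = CAppend)))"
  using assms by cases (((simp add: effect_defs; fail) | (simp add: effect_defs; blast))[1])+

lemma log_pos_le: "reachable Sys s \<Longrightarrow> log_pos s i \<le> length (clog s i)"
proof (induction rule: reachable_induct)
  case init show ?case by (simp add: init_state_def)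
next
  case (step s a t)
  from step.hyps(2) step.IH show ?case by cases (((simp; fail) | auto simp: effect_defs)[1])+
qed

lemma client_origin:
  "reachable Sys s \<Longrightarrow> T \<in> client s i \<Longrightarrow> origin Sys T = i \<and> i \<in> replicas Sys \<and> T \<in> issued s"
proof (induction rule: reachable_induct)
  case init then show ?case by (simp add: init_state_def)
next
  case (step s a t)
  from step.hyps(2) step.IH step.prems show ?case
    by cases (((simp; fail) | auto simp: effect_defs split: if_splits)[1])+
qed

lemma sender_origin:
  "reachable Sys s \<Longrightarrow>
   (spc s i \<noteq> SIdle \<longrightarrow> i \<in> replicas Sys) \<and>
   (\<forall>T. sender_tx (spc s i) = Some T \<longrightarrow> origin Sys T = i \<and> Tx T \<in> set (take (log_pos s i) (clog s i)))"
proof (induction rule: reachable_induct)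
  case init then show ?case by (simp add: init_state_def)
next
  case (step s a t)
  from step.hyps(2) step.IH log_pos_le[OF step.hyps(1), of i] show ?case
    by cases (((simp; fail) | auto simp: effect_defs take_Suc_conv_app_nth split: if_splits entry.splits)[1])+
qed

text \<open>No request is addressed to R1, its sender goes from \<open>SRead\<close> straight to
  \<open>SSend\<close> and its receivers straight to \<open>RExec\<close>. The absence of CpLog and
  of the program points that append or handle it support each other, hence one joint
  induction.\<close>

lemma initiator_pcs:
  "reachable Sys s \<Longrightarrow>
   CpLog \<notin> set (clog s 1) \<and> request_chan s 1 = 0 \<and> cpc s 1 = CIdle \<and> curr_color s 1 = Green \<and>
   (\<forall>J. kpc s = KRequest J \<longrightarrow> J \<subseteq> replicas Sys - {1}) \<and>
   (\<forall>T. spc s 1 \<noteq> SAppend T \<and> spc s 1 \<noteq> SColor T) \<and>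
   spc s 1 \<noteq> SCp \<and> spc s 1 \<noteq> SSetRed \<and> spc s 1 \<noteq> SReply \<and>
   (\<forall>j T c. rpc s (1, j) \<noteq> RTest1 T c \<and> rpc s (1, j) \<noteq> RCas T c \<and>
            rpc s (1, j) \<noteq> RTest2 T c \<and> rpc s (1, j) \<noteq> RAppend T c)"
proof (induction rule: reachable_induct)
  case init then show ?case by (simp add: init_state_def)
next
  case (step s a t)
  from step.hyps(2) step.IH show ?case
    by cases (((simp; fail) | auto simp: effect_defs split: if_splits entry.splits dest: nth_mem)[1])+
qed

lemma after_commit_initiator:
  "reachable Sys s \<Longrightarrow> after_commit (rpc s (i, j)) \<Longrightarrow> i = 1 \<and> receiver_msg (rpc s (i, j)) \<noteq> Some (T, Red)"
proof (induction rule: reachable_induct)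
  case init then show ?case by (simp add: init_state_def)
next
  case (step s a t)
  from step.hyps(2) step.IH step.prems show ?case
    by cases (((simp; fail) | auto simp: effect_defs split: if_splits)[1])+
qed

lemma in_flight_origin:
  "reachable Sys s \<Longrightarrow> in_flight s j i T c \<Longrightarrow>
   origin Sys T = j \<and> i \<noteq> j \<and> i \<in> replicas Sys \<and> j \<in> replicas Sys \<and> Tx T \<in> set (clog s j)"
proof (induction rule: reachable_induct)
  case init then show ?case by (simp add: init_state_def in_flight_def)
next
  case (step s a t)
  have "set (clog s j) \<subseteq> set (clog t j)"
    using clog_step[OF step.hyps(2)] by auto
  then show ?case
    using in_flight_step[OF step.hyps(2) step.prems] step.IH sender_origin[OF step.hyps(1), of j]
    by (auto dest!: in_set_takeD)
qed

lemmas exec_origin = in_flight_origin[OF _ in_flight_receiver, of _ _ _ _ "RExec T c" for T c, simplified]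

lemmas append_origin = in_flight_origin[OF _ in_flight_receiver, of _ _ _ _ "RAppend T c" for T c, simplified]

lemma control_replicas:
  "reachable Sys s \<Longrightarrow> cpc s i \<noteq> CIdle \<or> request_chan s i > 0 \<Longrightarrow> i \<in> replicas Sys \<and> i \<noteq> 1"
proof (induction rule: reachable_induct)
  case init then show ?case by (simp add: init_state_def)
next
  case (step s a t)
  from step.hyps(2) step.IH step.prems initiator_pcs[OF step.hyps(1)] show ?case
    by cases (((simp; fail) | auto simp: effect_defs split: if_splits)[1])+
qed

lemma clog_replicas: "reachable Sys s \<Longrightarrow> e \<in> set (clog s i) \<Longrightarrow> i \<in> replicas Sys"
proof (induction rule: reachable_induct)
  case init then show ?case by (simp add: init_state_def)
next
  case (step s a t)
  note r = step.hyps(1)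
  show ?case
    using clog_step[OF step.hyps(2)] step.IH step.prems sender_origin[OF r, of i]
      control_replicas[OF r, of i]
    by (auto split: if_splits dest: client_origin[OF r] exec_origin[OF r] append_origin[OF r])
qed

text \<open>A replica other than the origin commits only from a message in flight, and the origin
  committed before sending it.\<close>

lemma clog_origin:
  "reachable Sys s \<Longrightarrow> Tx T \<in> set (clog s i) \<Longrightarrow> Tx T \<in> set (clog s (origin Sys T))"
proof (induction rule: reachable_induct)
  case init then show ?case by (simp add: init_state_def)
next
  case (step s a t)
  note r = step.hyps(1)
  show ?case
    using clog_step[OF step.hyps(2)] step.IH step.prems
    by (auto split: if_splits dest: client_origin[OF r] exec_origin[OF r])
qed

text \<open>Issuing creates one token, which a local commit moves from \<open>client\<close> to the
  log and an abort destroys. A remote commit cannot occur at the origin, because messages never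
  return to their sender.\<close>

lemma issued_commits:
  "reachable Sys s \<Longrightarrow>
   count_list (clog s (origin Sys T)) (Tx T) + (if T \<in> client s (origin Sys T) then 1 else 0)
     \<le> (if T \<in> issued s then 1 else 0)"
proof (induction rule: reachable_induct)
  case init then show ?case by (simp add: init_state_def)
next
  case (step s a t)
  note r = step.hyps(1)
  from step.hyps(2) step.IH show ?case
    by cases (((simp add: effect_defs; fail) |
      auto simp: effect_defs split: if_splits dest: client_origin[OF r] exec_origin[OF r])[1])+
qed

section \<open>Counting the copies of a transaction in transit\<close>

definition in_channel :: "('tx \<times> color) multiset \<Rightarrow> 'tx \<Rightarrow> nat" where
  "in_channel M T = count (image_mset fst M) T"

lemma in_channel_simps [simp]:
  "in_channel {#} T = 0"
  "in_channel (add_mset (U, c) M) T = in_channel M T + of_bool (U = T)"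
  by (simp_all add: in_channel_def)

lemma in_channel_diff: "(U, c) \<in># M \<Longrightarrow> in_channel (M - {#(U, c)#}) T + of_bool (U = T) = in_channel M T"
  by (auto dest!: multi_member_split simp: in_channel_def)

lemma in_channel_pos: "in_channel M T > 0 \<longleftrightarrow> (\<exists>c. (T, c) \<in># M)"
  by (force simp: in_channel_def)

fun in_sender :: "'tx sender_pc \<Rightarrow> 'tx \<Rightarrow> nat" where
  "in_sender (SRead U) T = of_bool (U = T)"
| "in_sender (SAppend U) T = of_bool (U = T)"
| "in_sender (SColor U) T = of_bool (U = T)"
| "in_sender (SSend U c) T = of_bool (U = T)"
| "in_sender _ T = 0"

text \<open>\<open>RCkpt\<close> and \<open>RCount\<close> contribute 0: there the token has already
  moved to the log of the receiver.\<close>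

fun in_receiver :: "'tx receiver_pc \<Rightarrow> 'tx \<Rightarrow> nat" where
  "in_receiver (RTest1 U c) T = of_bool (U = T)"
| "in_receiver (RCas U c) T = of_bool (U = T)"
| "in_receiver (RTest2 U c) T = of_bool (U = T)"
| "in_receiver (RAppend U c) T = of_bool (U = T)"
| "in_receiver (RExec U c) T = of_bool (U = T)"
| "in_receiver _ T = 0"

text \<open>
  Conservation of messages: once fetched by the MessageSender, a transaction is, for every other
  replica, in exactly one of four places.
\<close>

lemma message_tokens:
  "reachable Sys s \<Longrightarrow> i \<in> replicas Sys \<Longrightarrow> i \<noteq> origin Sys T \<Longrightarrow>
   in_channel (chan s (origin Sys T, i)) T + in_receiver (rpc s (i, origin Sys T)) T +
   in_sender (spc s (origin Sys T)) T + count_list (clog s i) (Tx T) =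
   count_list (take (log_pos s (origin Sys T)) (clog s (origin Sys T))) (Tx T)"
proof (induction rule: reachable_induct)
  case init then show ?case by (simp add: init_state_def)
next
  case (step s a t)
  note r = step.hyps(1)
  note IH = step.IH[OF step.prems]
  from step.hyps(2) IH step.prems log_pos_le[OF r, of "origin Sys T"]
    show ?case
    by cases (((simp add: effect_defs; fail) |
      auto simp: effect_defs take_Suc_conv_app_nth split: if_splits entry.splits
       dest: client_origin[OF r] exec_origin[OF r] in_channel_diff[where T = T])[1])+
qed

text \<open>At the origin this is \<open>issued_commits\<close>. Elsewhere conservation bounds the
  commits by the occurrences in the part of the origin's log already read; outside
  \<open>replicas Sys\<close> logs are empty.\<close>

lemma commit_once: "reachable Sys s \<Longrightarrow> count_list (clog s i) (Tx T) \<le> 1"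
proof (cases "i = origin Sys T \<or> i \<notin> replicas Sys")
  case True
  assume r: "reachable Sys s"
  have "count_list (clog s i) (Tx T) = 0" if "i \<notin> replicas Sys"
    using clog_replicas[OF r, of "Tx T" i] that by (intro count_notin) blast
  then show ?thesis
    using issued_commits[OF r, of T] True by (auto split: if_splits)
next
  case False
  assume r: "reachable Sys s"
  let ?xs = "clog s (origin Sys T)" and ?n = "log_pos s (origin Sys T)"
  have "count_list (take ?n ?xs) (Tx T) \<le> count_list (take ?n ?xs @ drop ?n ?xs) (Tx T)"
    unfolding count_list_append by simp
  then show ?thesis
    using message_tokens[OF r, of i T] issued_commits[OF r, of T] False
    by (simp split: if_splits)
qed

section \<open>Colors\<close>

text \<open>Phrased by the checkpointing thread, which only moves forward;
  \<open>initiator_red\<close> ties it to RColor of R1.\<close>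

definition red1 :: "('tx, 'obj, 'val) state \<Rightarrow> bool" where
  "red1 s \<longleftrightarrow> kpc s \<noteq> KIdle \<and> kpc s \<noteq> KYellow"

lemma red1_mono: "step Sys s a t \<Longrightarrow> red1 s \<Longrightarrow> red1 t"
  by (erule step.cases) (auto simp: red1_def effect_defs)

lemma initiator_red: "reachable Sys s \<Longrightarrow> rcolor s 1 = Red \<longleftrightarrow> red1 s"
proof (induction rule: reachable_induct)
  case init then show ?case by (simp add: init_state_def red1_def)
next
  case (step s a t)
  from step.hyps(2) step.IH initiator_pcs[OF step.hyps(1)] show ?case
    by cases (((simp add: effect_defs red1_def; fail) | auto simp: effect_defs red1_def split: if_splits)[1])+
qed

fun quiet_receiver :: "'tx receiver_pc \<Rightarrow> bool" where
  "quiet_receiver (RCas T c) = False"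
| "quiet_receiver (RAppend T c) = False"
| "quiet_receiver (RCkpt T c) = False"
| "quiet_receiver (RTest1 T c) = (c = Green)"
| "quiet_receiver (RTest2 T c) = (c = Green)"
| "quiet_receiver (RExec T c) = (c = Green)"
| "quiet_receiver (RCount T c) = (c = Green)"
| "quiet_receiver RIdle = True"

fun quiet_sender :: "'tx sender_pc \<Rightarrow> bool" where
  "quiet_sender (SSend T c) = (c = Green)"
| "quiet_sender (SAppend T) = False"
| "quiet_sender SCp = False"
| "quiet_sender SSetRed = False"
| "quiet_sender SReply = False"
| "quiet_sender _ = True"

definition quiet :: "('tx, 'obj, 'val) state \<Rightarrow> replica \<Rightarrow> replica \<Rightarrow> bool" where
  "quiet s i j \<longleftrightarrow> store s = {#} \<and> cp_exec s = {} \<and> (i \<noteq> 1 \<longrightarrow> rcolor s i = Green) \<and> curr_color s i = Green \<and>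
     cpc s i = CIdle \<and> request_chan s i = 0 \<and> CpLog \<notin> set (clog s i) \<and> quiet_sender (spc s i) \<and>
     quiet_receiver (rpc s (i, j)) \<and> (\<forall>T c. (T, c) \<in># chan s (j, i) \<longrightarrow> c = Green) \<and> \<not> append_success s (i, j)"

text \<open>Colors and markers have their only sources in R1 being Red: until then it sends no
  request and, even when Yellow, colors its messages Green. Hence \<open>quiet\<close> exempts
  RColor of R1. The induction ranges over all pairs, since a marker could come through any
  channel.\<close>

lemma quiet_before_red: "reachable Sys s \<Longrightarrow> \<not> red1 s \<Longrightarrow> quiet s i j"
proof (induction arbitrary: i j rule: reachable_induct)
  case init then show ?case by (simp add: init_state_def quiet_def)
next
  case (step s a t i j)
  have q: "\<And>i j. quiet s i j"
    using step.IH red1_mono[OF step.hyps(2)] step.prems by blast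
  have dest: "\<And>i p. spc s i = p \<Longrightarrow> quiet_sender p"
    "\<And>i j r. rpc s (i, j) = r \<Longrightarrow> quiet_receiver r"
    "\<And>i c. cpc s i = c \<Longrightarrow> c = CIdle"
    "\<And>j T c. rpc s (1, j) = RTest2 T c \<Longrightarrow> False"
    using q initiator_pcs[OF step.hyps(1)] unfolding quiet_def by blast+
  have "rcolor s 1 \<noteq> Red"
    using initiator_red[OF step.hyps(1)] red1_mono[OF step.hyps(2)] step.prems by blast
  with step.hyps(2) q[of i j] step.prems show ?case
    by cases (((simp add: effect_defs quiet_def; fail) | ((frule dest(2), simp); fail) |
      auto simp: effect_defs quiet_def red1_def split: if_splits entry.splits dest: dest nth_mem in_diffD)[1])+
qed

section \<open>The MessageSender in isolation\<close>

lemma clog_extends: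
  assumes "step Sys s a t"
  obtains ys where "clog t i = clog s i @ ys"
  using clog_step[OF assms] by (metis append_Nil2 fun_upd_apply)

text \<open>Projection of a step to the four variables owned by one MessageSender;
  \<open>stay\<close> absorbs all other actions. \<open>xs\<close> and \<open>rc\<close> are the log
  and RColor before the step, which other threads may change between two sender steps.\<close>

inductive sender_step ::
  "('tx, 'obj, 'val) system \<Rightarrow> replica \<Rightarrow> 'tx entry list \<Rightarrow> color \<Rightarrow>
   'tx sender_pc \<times> nat \<times> color \<times> nat \<Rightarrow> 'tx sender_pc \<times> nat \<times> color \<times> nat \<Rightarrow> bool"
  for Sys i xs rc
where
  stay: "sender_step Sys i xs rc z z"
| fetch_tx: "n < length xs \<Longrightarrow> xs ! n = Tx T \<Longrightarrow> p = (if origin Sys T = i then SRead T else SIdle) \<Longrightarrow>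
    sender_step Sys i xs rc (SIdle, n, c, k) (p, Suc n, c, k)"
| fetch_cplog: "n < length xs \<Longrightarrow> xs ! n = CpLog \<Longrightarrow>
    sender_step Sys i xs rc (SIdle, n, c, k) (SCp, Suc n, c, k)"
| read: "p = (if i = 1 then SSend T (if rc = Red then Red else Green)
              else if c \<noteq> rc \<and> rc = Yellow then SAppend T else SColor T) \<Longrightarrow>
    sender_step Sys i xs rc (SRead T, n, c, k) (p, n, c, k)"
| append: "sender_step Sys i xs rc (SAppend T, n, c, k) (SColor T, n, rc, k)"
| color: "sender_step Sys i xs rc (SColor T, n, c, k) (SSend T c, n, c, Suc k)"
| send: "sender_step Sys i xs rc (SSend T c', n, c, k) (SIdle, n, c, k)"
| test: "p = (if rc = Red then SIdle else SSetRed) \<Longrightarrow>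
    sender_step Sys i xs rc (SCp, n, c, k) (p, n, c, k)"
| set_red: "sender_step Sys i xs rc (SSetRed, n, c, k) (SReply, n, Red, k)"
| reply: "sender_step Sys i xs rc (SReply, n, c, k) (SIdle, n, c, k)"

abbreviation sender_state :: "('tx, 'obj, 'val) state \<Rightarrow> replica \<Rightarrow> 'tx sender_pc \<times> nat \<times> color \<times> nat" where
  "sender_state s i \<equiv> (spc s i, log_pos s i, curr_color s i, sent_count s i)"

lemma step_sender_step:
  assumes "step Sys s a t"
  shows "sender_step Sys i (clog s i) (rcolor s i) (sender_state s i) (sender_state t i)"
  using assms
proof cases
  case (fetch k e)
  show ?thesis
  proof (cases e)
    case (Tx T)
    with fetch have "clog s k ! log_pos s k = Tx T" by simp
    with fetch show ?thesis by (cases "i = k") (auto intro: stay sender_step.fetch_tx)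
  next
    case CpLog
    with fetch have "clog s k ! log_pos s k = CpLog" by simp
    with fetch show ?thesis by (cases "i = k") (auto intro: stay sender_step.fetch_cplog)
  qed
qed (((simp add: effect_defs stay; fail) | (auto simp: effect_defs intro: sender_step.intros))[1])+

text \<open>Away from R1, RColor becomes Red only by the replica's own MessageSender. This keeps
  \<open>curr_color\<close> and RColor in agreement about Red although other threads write
  RColor.\<close>

lemma rcolor_step:
  assumes "step Sys s a t"
  shows "if spc s i = SSetRed \<and> spc t i = SReply then rcolor t i = Red
    else rcolor t i = rcolor s i \<or> rcolor s i = Green \<and> rcolor t i = Yellow \<or> i = 1"
  using assms by cases (((simp add: effect_defs; fail) | (auto simp: effect_defs))[1])+

text \<open>\<open>curr_color\<close> is Red iff a CpLog entry has been read, except at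
  \<open>SCp\<close> and \<open>SSetRed\<close>: the CpLog just fetched is not yet reflected there,
  so the prefix is shorter by one.\<close>

definition sender_ok :: "'tx entry list \<Rightarrow> 'tx sender_pc \<times> nat \<times> color \<times> nat \<Rightarrow> bool" where
  "sender_ok xs = (\<lambda>(p, n, c, _).
     (if p = SCp \<or> p = SSetRed
      then \<exists>m<length xs. n = Suc m \<and> xs ! m = CpLog \<and> (c = Red \<longleftrightarrow> CpLog \<in> set (take m xs))
      else c = Red \<longleftrightarrow> CpLog \<in> set (take n xs)) \<and>
     (p = SSetRed \<longrightarrow> c \<noteq> Red) \<and> (p = SReply \<longrightarrow> c = Red))"

lemma sender_ok_append: "sender_ok xs (p, n, z) \<Longrightarrow> n \<le> length xs \<Longrightarrow> sender_ok (xs @ ys) (p, n, z)"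
  by (auto simp: sender_ok_def nth_append split: if_splits)

text \<open>Agreement of \<open>curr_color\<close> with RColor about Red matters only where RColor
  is tested (\<open>SCp\<close>) or copied (\<open>SAppend\<close>). R1 reaches neither, so the
  lemma applies to it as well.\<close>

lemma sender_ok_step:
  assumes "sender_step Sys i xs rc z z'" "sender_ok xs z" "fst (snd z) \<le> length xs"
    "fst z = SCp \<or> (\<exists>T. fst z = SAppend T) \<longrightarrow> (fst (snd (snd z)) = Red \<longleftrightarrow> rc = Red)"
  shows "sender_ok xs z'"
  using assms by cases (auto simp: sender_ok_def take_Suc_conv_app_nth split: if_splits)

lemma sender_colors:
  "reachable Sys s \<Longrightarrow>
   sender_ok (clog s i) (sender_state s i) \<and> (i \<noteq> 1 \<longrightarrow> (curr_color s i = Red \<longleftrightarrow> rcolor s i = Red))"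
proof (induction rule: reachable_induct)
  case init then show ?case by (simp add: init_state_def sender_ok_def)
next
  case (step s a t)
  note r = step.hyps(1)
  note ss = step_sender_step[OF step.hyps(2), of i]
  have "i = 1 \<longrightarrow> \<not> (spc s i = SCp \<or> (\<exists>T. spc s i = SAppend T))"
    using initiator_pcs[OF r] by blast
  then have "sender_ok (clog s i) (sender_state t i)"
    using sender_ok_step[OF ss] step.IH log_pos_le[OF r, of i] by auto
  moreover have "log_pos t i \<le> length (clog s i)"
    using ss log_pos_le[OF r, of i] by cases auto
  ultimately have 1: "sender_ok (clog t i) (sender_state t i)"
    using clog_extends[OF step.hyps(2), of i] sender_ok_append by metis
  have "curr_color t i = Red \<longleftrightarrow> rcolor t i = Red" if "i \<noteq> 1"
    using ss step.IH that rcolor_step[OF step.hyps(2), of i] by cases (auto split: if_splits)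
  with 1 show ?case by blast
qed

lemma red_cplog:
  assumes r: "reachable Sys s" and "i \<noteq> 1" "rcolor s i = Red"
  shows "CpLog \<in> set (clog s i)"
  using sender_colors[OF r, of i] assms(2,3)
  by (auto simp: sender_ok_def split: if_splits dest: in_set_takeD)

lemma append_success_cplog: "reachable Sys s \<Longrightarrow> append_success s (i, j) \<Longrightarrow> CpLog \<in> set (clog s i)"
proof (induction rule: reachable_induct)
  case init then show ?case by (simp add: init_state_def)
next
  case (step s a t)
  from step.hyps(2) step.IH step.prems show ?case
    by cases (((simp add: effect_defs; fail) | auto simp: effect_defs split: if_splits)[1])+
qed

text \<open>Failing the first test with a non-Green message means that RColor has left Green, for
  good. At the second test Red means that a CpLog was read, Yellow with
  \<open>append_success\<close> that this thread appended one earlier; otherwise it appends one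
  now.\<close>

lemma receiver_cplog:
  "reachable Sys s \<Longrightarrow> i \<noteq> 1 \<Longrightarrow> c \<noteq> Green \<Longrightarrow>
   (rpc s (i, j) = RTest2 T c \<longrightarrow> rcolor s i \<noteq> Green) \<and>
   (rpc s (i, j) = RExec T c \<longrightarrow> CpLog \<in> set (clog s i))"
proof (induction rule: reachable_induct)
  case init then show ?case by (simp add: init_state_def)
next
  case (step s a t)
  note r = step.hyps(1)
  have "rcolor s i = Green \<or> rcolor s i = Yellow \<or> rcolor s i = Red"
    by (cases "rcolor s i") auto
  with step.hyps(2) step.IH step.prems red_cplog[OF r, of i] append_success_cplog[OF r, of i j] show ?case
    by cases (((simp add: effect_defs; fail) | auto simp: effect_defs split: if_splits)[1])+
qed

section \<open>Log entries before the first CpLog\<close>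

definition pre :: "'tx entry list \<Rightarrow> 'tx entry list" where
  "pre xs = takeWhile (\<lambda>e. e \<noteq> CpLog) xs"

lemma pre_append: "pre (xs @ ys) = (if CpLog \<in> set xs then pre xs else xs @ pre ys)"
  by (auto simp: pre_def takeWhile_append)

lemma pre_Cons: "pre (x # xs) = (if x = CpLog then [] else x # pre xs)"
  by (simp add: pre_def)

lemma pre_Nil [simp]: "pre [] = []"
  by (simp add: pre_def)

lemma pre_id: "CpLog \<notin> set xs \<Longrightarrow> pre xs = xs"
  unfolding pre_def takeWhile_eq_all_conv by auto

lemma set_pre_subset: "set (pre xs) \<subseteq> set xs"
  by (auto simp: pre_def dest: set_takeWhileD)

lemma mem_pre_append:
  assumes "x \<in> set xs" "count_list (xs @ ys) x \<le> 1"
  shows "x \<in> set (pre (xs @ ys)) \<longleftrightarrow> x \<in> set (pre xs)"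
proof -
  have "count_list xs x \<noteq> 0" using assms(1) by (simp add: count_list_0_iff)
  with assms(2) have "count_list ys x = 0" unfolding count_list_append by linarith
  then have "x \<notin> set ys" by (simp add: count_list_0_iff)
  then show ?thesis
    using assms(1) set_pre_subset[of ys] pre_id[of xs] by (auto simp: pre_append)
qed

text \<open>An earlier occurrence of \<open>x\<close> could lie before the first CpLog while
  position \<open>n\<close> lies after it; having a single occurrence excludes this.\<close>

lemma mem_pre_iff:
  assumes "n < length xs" "xs ! n = x" "x \<noteq> CpLog" "count_list xs x \<le> 1"
  shows "x \<in> set (pre xs) \<longleftrightarrow> CpLog \<notin> set (take n xs)"
proof -
  obtain ys zs where xs: "xs = ys @ x # zs" and n: "n = length ys"
    using id_take_nth_drop[OF assms(1)] assms(1,2) by (metis length_take min.absorb4)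
  have "count_list ys x = 0"
    using assms(4) by (simp add: xs)
  then have "x \<notin> set ys"
    by (simp add: count_list_0_iff)
  then show ?thesis
    using set_pre_subset[of ys] assms(3) by (auto simp: xs n pre_append pre_Cons)
qed

text \<open>Before \<open>R1\<close> becomes Red, its local cut is understood to be what it has committed so far.\<close>

definition early :: "('tx, 'obj, 'val) system \<Rightarrow> ('tx, 'obj, 'val) state \<Rightarrow> 'tx \<Rightarrow> bool" where
  "early Sys s T \<longleftrightarrow>
     (if origin Sys T = 1 then T \<in> (if red1 s then cut s else committed_at s 1)
      else Tx T \<in> set (pre (clog s (origin Sys T))))"

lemma cut_step:
  assumes "step Sys s a t"
  shows "if red1 s then cut t = cut s \<and> base t = base s
    else if red1 t then cut t = committed_at s 1 \<and> clog t = clog s \<and> base t = db s 1 \<and> kpc t = KRecord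
    else True"
  using assms by cases (((simp add: effect_defs red1_def; fail) | auto simp: effect_defs red1_def split: if_splits)[1])+

text \<open>From its commit at the origin on, earliness is a property of the transaction: entries
  appended later fall behind its occurrence. For origin 1 the definition passes from the log to
  \<open>cut\<close> at the moment when the two coincide.\<close>

lemma early_stable:
  assumes r: "reachable Sys s" and st: "step Sys s a t" and T: "Tx T \<in> set (clog s (origin Sys T))"
  shows "early Sys t T \<longleftrightarrow> early Sys s T"
proof (cases "origin Sys T = 1")
  case True
  obtain ys where "clog t 1 = clog s 1 @ ys"
    using clog_extends[OF st] by blast
  then have "T \<in> committed_at t 1" "T \<in> committed_at s 1"
    using T True by (auto simp: committed_at_def)
  then show ?thesis
    using cut_step[OF st] red1_mono[OF st] True by (simp add: early_def split: if_splits)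
next
  case False
  obtain ys where ys: "clog t (origin Sys T) = clog s (origin Sys T) @ ys"
    using clog_extends[OF st] by blast
  have "count_list (clog t (origin Sys T)) (Tx T) \<le> 1"
    by (rule commit_once[OF reachable_step[OF r st]])
  then show ?thesis
    using mem_pre_append[OF T, of ys] False by (simp add: early_def ys)
qed

lemma early_read:
  assumes r: "reachable Sys s" and "n < length (clog s i)" "clog s i ! n = Tx T" "origin Sys T = i" "i \<noteq> 1"
  shows "early Sys s T \<longleftrightarrow> CpLog \<notin> set (take n (clog s i))"
  using mem_pre_iff[OF assms(2,3) _ commit_once[OF r]] assms(4,5) by (simp add: early_def)

text \<open>When the entry is fetched, \<open>sender_ok\<close> and \<open>early_read\<close> equate
  Red with not being early. Until the message is sent no further CpLog is read, so at most Green
  turns into Yellow. For R1 the converse fails: a transaction of the cut may be colored after the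
  switch.\<close>

lemma sender_message_color:
  "reachable Sys s \<Longrightarrow>
   (j \<noteq> 1 \<and> (spc s j = SRead T \<or> spc s j = SAppend T \<or> spc s j = SColor T) \<longrightarrow>
      (curr_color s j = Red \<longleftrightarrow> \<not> early Sys s T)) \<and>
   (spc s j = SSend T c \<longrightarrow> (c \<noteq> Red \<longrightarrow> early Sys s T) \<and> (j \<noteq> 1 \<and> c = Red \<longrightarrow> \<not> early Sys s T))"
proof (induction rule: reachable_induct)
  case init then show ?case by (simp add: init_state_def)
next
  case (step s a t)
  note r = step.hyps(1)
  have st: "Tx T \<in> set (clog s (origin Sys T)) \<Longrightarrow> early Sys t T = early Sys s T"
    using early_stable[OF r step.hyps(2)] by blast
  have so: "sender_tx (spc s j) = Some T \<Longrightarrow> origin Sys T = j \<and> early Sys t T = early Sys s T"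
    using sender_origin[OF r, of j] st by (auto dest: in_set_takeD)
  \<comment> \<open>While R1 is not Red, \<open>early\<close> means committed at R1, which holds for
    every entry already fetched.\<close>
  have one: "sender_tx (spc s 1) = Some T \<Longrightarrow> rcolor s 1 \<noteq> Red \<Longrightarrow> early Sys s T"
    using initiator_red[OF r] sender_origin[OF r, of 1]
    by (auto simp: early_def committed_at_def dest: in_set_takeD)
  have ini: "spc s 1 \<noteq> SColor T"
    using initiator_pcs[OF r] by blast
  from step_sender_step[OF step.hyps(2), of j] show ?case
  proof cases
    case stay
    then show ?thesis using step.IH so by auto
  next
    case (fetch_tx U)
    then have "early Sys s T \<longleftrightarrow> CpLog \<notin> set (take (log_pos s j) (clog s j))" "early Sys t T = early Sys s T"
      if "U = T" "origin Sys T = j" "j \<noteq> 1"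
      using early_read[OF r, of "log_pos s j" j T] that st nth_mem[of "log_pos s j" "clog s j"] by auto
    with fetch_tx sender_colors[OF r, of j] show ?thesis by (auto simp: sender_ok_def)
  next
    case (append U)
    then have "j \<noteq> 1" using initiator_pcs[OF r] by blast
    with append show ?thesis using step.IH so sender_colors[OF r, of j] by auto
  qed (use step.IH so one ini in \<open>auto split: if_splits\<close>)
qed

lemma message_color:
  "reachable Sys s \<Longrightarrow> in_flight s j i T c \<Longrightarrow>
    (c \<noteq> Red \<longrightarrow> early Sys s T) \<and> (j \<noteq> 1 \<and> c = Red \<longrightarrow> \<not> early Sys s T)"
proof (induction rule: reachable_induct)
  case init then show ?case by (simp add: init_state_def in_flight_def)
next
  case (step s a t)
  note r = step.hyps(1)
  have "Tx T \<in> set (clog s (origin Sys T))"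
    using in_flight_step[OF step.hyps(2) step.prems] in_flight_origin[OF r] sender_origin[OF r, of j]
    by (auto dest: in_set_takeD)
  then have "early Sys t T = early Sys s T"
    by (rule early_stable[OF r step.hyps(2)])
  then show ?case
    using in_flight_step[OF step.hyps(2) step.prems] step.IH sender_message_color[OF r, of j T c] by auto
qed

lemma pre_early:
  "reachable Sys s \<Longrightarrow> i \<noteq> 1 \<Longrightarrow> Tx U \<in> set (pre (clog s i)) \<Longrightarrow> early Sys s U"
proof (induction rule: reachable_induct)
  case init then show ?case by (simp add: init_state_def)
next
  case (step s a t)
  note r = step.hyps(1)
  show ?case
  proof (cases "i = origin Sys U")
    case True
    then show ?thesis using step.prems by (simp add: early_def)
  next
    case False
    have "early Sys s U \<and> Tx U \<in> set (clog s (origin Sys U))"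
    proof (cases "Tx U \<in> set (pre (clog s i))")
      case True
      then show ?thesis
        using step.IH[OF step.prems(1)] clog_origin[OF r] set_pre_subset by blast
    next
      \<comment> \<open>\<open>U\<close> enters the prefix only by being appended while the log has
        no CpLog, so its message must be Green.\<close>
      case nin: False
      then obtain j c where c: "rpc s (i, j) = RExec U c" "CpLog \<notin> set (clog s i)"
        using step.prems clog_step[OF step.hyps(2)] False client_origin[OF r, of U i]
          pre_id[of "clog s i"]
        by (auto simp: pre_append pre_Cons split: if_splits)
      then have "c = Green"
        using receiver_cplog[OF r step.prems(1)] by blast
      then show ?thesis
        using message_color[OF r in_flight_receiver[OF c(1)]] exec_origin[OF r c(1)] by simp
    qed
    then show ?thesis
      using early_stable[OF r step.hyps(2)] by blast
  qed
qed

section \<open>The stored checkpoint\<close>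

text \<open>The token at \<open>RExec\<close> uses up the single occurrence at the origin, so
  conservation leaves none for the log of \<open>i\<close>.\<close>

lemma exec_fresh:
  assumes r: "reachable Sys s" and c: "rpc s (i, j) = RExec T c"
  shows "Tx T \<notin> set (clog s i)"
proof -
  have o: "origin Sys T = j" "i \<noteq> j" "i \<in> replicas Sys"
    using exec_origin[OF r c] by auto
  let ?xs = "clog s j" and ?n = "log_pos s j"
  have "count_list (take ?n ?xs) (Tx T) \<le> count_list (take ?n ?xs @ drop ?n ?xs) (Tx T)"
    unfolding count_list_append by simp
  then have "count_list (clog s i) (Tx T) = 0"
    using message_tokens[OF r, of i T] commit_once[OF r, of j T] o c by simp
  then show ?thesis by (simp add: count_list_0_iff)
qed

lemma client_fresh:
  assumes r: "reachable Sys s" and "T \<in> client s i"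
  shows "Tx T \<notin> set (clog s i)"
  using issued_commits[OF r, of T] client_origin[OF r assms(2)] assms(2)
  by (auto simp: count_list_0_iff split: if_splits)

lemma commit_step:
  assumes "step Sys s a t" "Tx T \<in> set (clog t i)" "Tx T \<notin> set (clog s i)"
  obtains (local) "T \<in> client s i" "clog t = (clog s)(i := clog s i @ [Tx T])"
      "db t = (db s)(i := apply_tx Sys T (db s i))" "rpc t = rpc s" "recv_count t = recv_count s"
    | (remote) j c where "rpc s (i, j) = RExec T c" "clog t = (clog s)(i := clog s i @ [Tx T])"
      "db t = (db s)(i := apply_tx Sys T (db s i))" "recv_count t = recv_count s"
      "rpc t = (rpc s)((i, j) := (if i \<noteq> 1 \<or> c = Red then RIdle
          else if rcolor s 1 = Red then RCkpt T c else RCount T c))"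
proof -
  have "(T \<in> client s i \<and> clog t = (clog s)(i := clog s i @ [Tx T]) \<and>
      db t = (db s)(i := apply_tx Sys T (db s i)) \<and> rpc t = rpc s \<and> recv_count t = recv_count s) \<or>
    (\<exists>j c. rpc s (i, j) = RExec T c \<and> clog t = (clog s)(i := clog s i @ [Tx T]) \<and>
      db t = (db s)(i := apply_tx Sys T (db s i)) \<and> recv_count t = recv_count s \<and>
      rpc t = (rpc s)((i, j) := (if i \<noteq> 1 \<or> c = Red then RIdle
          else if rcolor s 1 = Red then RCkpt T c else RCount T c)))"
    using assms by cases (((simp add: effect_defs; fail) | (auto simp: effect_defs split: if_splits))[1])+
  then show ?thesis using local remote by blast
qed

lemma db_step:
  assumes "step Sys s a t"
  shows "db t i = db s i \<and> committed_at t i = committed_at s i \<or>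
    (\<exists>T. Tx T \<in> set (clog t i) \<and> (T \<in> client s i \<or> (\<exists>j c. rpc s (i, j) = RExec T c)) \<and>
       committed_at t i = insert T (committed_at s i) \<and> db t i = apply_tx Sys T (db s i))"
  using assms by cases (((simp add: effect_defs committed_at_def; fail) | (auto simp: effect_defs committed_at_def))[1])+

text \<open>Distinctness is part of the claim because order independence is granted only for
  repetition-free lists; it comes from the freshness of each commit.\<close>

lemma db_committed:
  "reachable Sys s \<Longrightarrow> \<exists>xs. distinct xs \<and> set xs = committed_at s i \<and> db s i = db_after Sys xs"
proof (induction rule: reachable_induct)
  case init
  show ?case by (rule exI[of _ "[]"]) (simp add: init_state_def committed_at_def db_after_def)
next
  case (step s a t)
  note r = step.hyps(1)
  obtain xs where xs: "distinct xs" "set xs = committed_at s i" "db s i = db_after Sys xs"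
    using step.IH by blast
  show ?case
  proof (cases "db t i = db s i \<and> committed_at t i = committed_at s i")
    case True
    with xs show ?thesis by auto
  next
    case False
    then obtain T where T: "T \<in> client s i \<or> (\<exists>j c. rpc s (i, j) = RExec T c)"
      "committed_at t i = insert T (committed_at s i)" "db t i = apply_tx Sys T (db s i)"
      using db_step[OF step.hyps(2), of i] by blast
    have "T \<notin> committed_at s i"
      using T(1) client_fresh[OF r] exec_fresh[OF r] by (auto simp: committed_at_def)
    with xs T(2,3) show ?thesis
      by (intro exI[of _ "xs @ [T]"]) (simp add: db_after_def)
  qed
qed

lemma cut_prefix:
  "reachable Sys s \<Longrightarrow> red1 s \<Longrightarrow> \<exists>m\<le>length (clog s 1). cut s = {T. Tx T \<in> set (take m (clog s 1))}"
proof (induction rule: reachable_induct)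
  case init then show ?case by (simp add: init_state_def red1_def)
next
  case (step s a t)
  show ?case
  proof (cases "red1 s")
    case True
    then obtain m where m: "m \<le> length (clog s 1)" "cut s = {T. Tx T \<in> set (take m (clog s 1))}"
      using step.IH by blast
    obtain ys where "clog t 1 = clog s 1 @ ys"
      using clog_extends[OF step.hyps(2)] by blast
    then show ?thesis
      using m cut_step[OF step.hyps(2)] True by (intro exI[of _ m]) simp
  next
    case False
    then show ?thesis
      using cut_step[OF step.hyps(2)] step.prems
      by (intro exI[of _ "length (clog t 1)"]) (simp add: committed_at_def)
  qed
qed

lemma cut_committed: "reachable Sys s \<Longrightarrow> red1 s \<Longrightarrow> T \<in> cut s \<Longrightarrow> Tx T \<in> set (clog s 1)"
  using cut_prefix by (fastforce dest: in_set_takeD)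

text \<open>At the switch no log contains a CpLog, so everything R1 has committed by then is early,
  wherever it was issued.\<close>

lemma cut_early: "reachable Sys s \<Longrightarrow> red1 s \<Longrightarrow> T \<in> cut s \<Longrightarrow> early Sys s T"
proof (induction rule: reachable_induct)
  case init then show ?case by (simp add: init_state_def red1_def)
next
  case (step s a t)
  note r = step.hyps(1)
  have T: "Tx T \<in> set (clog s 1) \<and> early Sys s T"
  proof (cases "red1 s")
    case True
    then show ?thesis
      using step.IH step.prems cut_step[OF step.hyps(2)] cut_committed[OF r] by simp
  next
    case False
    then have T1: "Tx T \<in> set (clog s 1)"
      using step.prems cut_step[OF step.hyps(2)] by (simp add: committed_at_def)
    have "CpLog \<notin> set (clog s (origin Sys T))"
      using quiet_before_red[OF r False] unfolding quiet_def by blast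
    with T1 False show ?thesis
      using clog_origin[OF r T1] by (simp add: early_def committed_at_def pre_id)
  qed
  then show ?case
    using early_stable[OF r step.hyps(2) clog_origin[OF r]] by blast
qed

lemma checkpoint_step:
  assumes r: "reachable Sys s" and st: "step Sys s a t"
  obtains (stay) "store t = store s" "cp_exec t = cp_exec s"
    | (copy) x where "red1 s" "\<not> stored s x" "store t = add_mset (x, base s x) (store s)"
        "cp_exec t = cp_exec s"
    | (exec) i j T c where "rpc s (i, j) = RCkpt T c" "rpc t (i, j) = RCount T c"
        "store t = store (exec_on_checkpoint Sys T s)" "cp_exec t = insert T (cp_exec s)"
proof -
  have "(store t = store s \<and> cp_exec t = cp_exec s) \<or>
    (\<exists>x. red1 s \<and> \<not> stored s x \<and> store t = add_mset (x, base s x) (store s) \<and> cp_exec t = cp_exec s) \<or>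
    (\<exists>i j T c. rpc s (i, j) = RCkpt T c \<and> rpc t (i, j) = RCount T c \<and>
        store t = store (exec_on_checkpoint Sys T s) \<and> cp_exec t = insert T (cp_exec s))"
    using st initiator_red[OF r]
    by cases (((simp add: effect_defs; fail) | (auto simp: effect_defs red1_def split: if_splits))[1])+
  then show ?thesis using stay copy exec by blast
qed

lemma ckpt_origin:
  assumes "reachable Sys s" "rpc s (i, j) = RCkpt T c"
  shows "i = 1 \<and> origin Sys T = j \<and> j \<noteq> 1 \<and> c \<noteq> Red \<and> in_flight s j 1 T c"
  using after_commit_initiator[OF assms(1), of i j T] in_flight_receiver[OF assms(2), of T c]
    in_flight_origin[OF assms(1), of j i T c] assms(2) by auto

lemma ckpt_inv:
  assumes "step Sys s a t" "rpc t (i, j) = RCkpt T c"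
  shows "rpc s (i, j) = RCkpt T c \<or> rpc s (i, j) = RExec T c \<and> i = 1 \<and> rcolor s 1 = Red"
  using assms by cases (((simp add: effect_defs; fail) | (auto simp: effect_defs split: if_splits))[1])+

text \<open>The second conjunct bridges the gap between commit and execution on the checkpoint. A
  commit leading to \<open>RCkpt\<close> happens when R1 is Red and concerns a fresh transaction,
  hence one outside both \<open>cut\<close> and \<open>cp_exec\<close>.\<close>

lemma exec_committed:
  "reachable Sys s \<Longrightarrow>
   (T \<in> cp_exec s \<longrightarrow> Tx T \<in> set (clog s 1) \<and> T \<notin> cut s \<and> origin Sys T \<noteq> 1 \<and> red1 s \<and> early Sys s T) \<and>
   (\<forall>c. rpc s (1, origin Sys T) = RCkpt T c \<longrightarrow> Tx T \<in> set (clog s 1) \<and> T \<notin> cut s \<and> T \<notin> cp_exec s \<and> red1 s)"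
proof (induction rule: reachable_induct)
  case init then show ?case by (simp add: init_state_def)
next
  case (step s a t)
  note r = step.hyps(1) and st = step.hyps(2)
  obtain ys where ys: "clog t 1 = clog s 1 @ ys"
    using clog_extends[OF st] by blast
  have cut: "red1 s \<Longrightarrow> T \<notin> cut s \<Longrightarrow> T \<notin> cut t \<and> red1 t"
    using cut_step[OF st] red1_mono[OF st] by simp
  have ck: "Tx T \<in> set (clog s 1) \<and> T \<notin> cut s \<and> T \<notin> cp_exec s \<and> red1 s \<and> origin Sys T \<noteq> 1 \<and> early Sys s T"
    if "rpc s (i, j) = RCkpt T d" for i j d
    using ckpt_origin[OF r that] step.IH message_color[OF r, of j 1 T d] that by auto
  have 1: "Tx T \<in> set (clog t 1) \<and> T \<notin> cut t \<and> origin Sys T \<noteq> 1 \<and> red1 t \<and> early Sys t T"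
    if "T \<in> cp_exec t"
  proof -
    have "Tx T \<in> set (clog s 1) \<and> T \<notin> cut s \<and> origin Sys T \<noteq> 1 \<and> red1 s \<and> early Sys s T"
      using r st by (cases rule: checkpoint_step) (use that step.IH ck in auto)
    then show ?thesis
      using ys cut early_stable[OF r st clog_origin[OF r]] by auto
  qed
  have 2: "Tx T \<in> set (clog t 1) \<and> T \<notin> cut t \<and> T \<notin> cp_exec t \<and> red1 t"
    if c: "rpc t (1, origin Sys T) = RCkpt T c" for c
  proof -
    have s: "Tx T \<in> set (clog t 1) \<and> T \<notin> cut s \<and> T \<notin> cp_exec s \<and> red1 s"
      using ckpt_inv[OF st c]
    proof (elim disjE conjE)
      assume "rpc s (1, origin Sys T) = RCkpt T c"
      then show ?thesis using step.IH ys by auto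
    next
      assume ex: "rpc s (1, origin Sys T) = RExec T c" and red: "rcolor s 1 = Red"
      have "Tx T \<in> set (clog t 1)"
        using st ex c by cases (auto simp: effect_defs split: if_splits)
      then show ?thesis
        using exec_fresh[OF r ex] cut_committed[OF r] step.IH red initiator_red[OF r] by blast
    qed
    have "T \<notin> cp_exec t"
      using r st
    proof (cases rule: checkpoint_step)
      \<comment> \<open>\<open>U\<close> differs from \<open>T\<close>: otherwise it would be
        handled by the same receiver, which this step takes to \<open>RCount\<close>, whereas
        \<open>T\<close> is still at \<open>RCkpt\<close>.\<close>
      case (exec i j U d)
      then show ?thesis using s c ckpt_origin[OF r exec(1)] by auto
    qed (use s in auto)
    then show ?thesis using s cut by blast
  qed
  show ?case using 1 2 by blast
qed

section \<open>Copies and view of the stored checkpoint\<close>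

lemma exec_on_checkpoint_mem:
  fixes s :: "('tx, 'obj::finite, 'val) state"
  shows "(x, v) \<in># store (exec_on_checkpoint Sys T s) \<longleftrightarrow>
    (if x \<in> keys Sys T then v = apply_tx Sys T (checkpoint_view s) x else (x, v) \<in># store s)"
  by (auto simp: exec_on_checkpoint_def)

lemma exec_on_checkpoint_copies:
  fixes s :: "('tx, 'obj::finite, 'val) state"
  shows "copies (exec_on_checkpoint Sys T s) x = (if x \<in> keys Sys T then 1 else copies s x)"
proof -
  have 1: "{#e \<in># {#(y, f y). y \<in># mset_set K#}. fst e = x#} = (if x \<in> K then {#(x, f x)#} else {#})"
    if "finite K" for K :: "'obj set" and f :: "'obj \<Rightarrow> 'val"
    using that by induction auto
  have 2: "{#e \<in># {#(y, v) \<in># M. y \<notin> K#}. fst e = x#} = (if x \<in> K then {#} else {#e \<in># M. fst e = x#})"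
    for M :: "('obj \<times> 'val) multiset" and K
    by (induction M) auto
  show ?thesis
    unfolding copies_def exec_on_checkpoint_def by (simp add: 1 2)
qed

lemma copies_cong: "store t = store s \<Longrightarrow> copies t = copies s"
  by (simp add: copies_def fun_eq_iff)

lemma stored_cong: "store t = store s \<Longrightarrow> stored t = stored s"
  by (simp add: stored_def fun_eq_iff)

lemma stored_iff: "stored s x \<longleftrightarrow> copies s x > 0"
proof -
  have "(\<exists>v. (x, v) \<in># M) \<longleftrightarrow> size {#e \<in># M. fst e = x#} > 0" for M :: "('b \<times> 'c) multiset"
  proof
    assume "size {#e \<in># M. fst e = x#} > 0"
    then obtain e where "e \<in># {#e \<in># M. fst e = x#}"
      by (auto simp: nonempty_has_size[symmetric] dest: multiset_nonemptyE)
    then show "\<exists>v. (x, v) \<in># M" by (cases e) auto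
  qed (auto dest: multi_member_split)
  then show ?thesis by (simp add: stored_def copies_def)
qed

lemma copy_unique:
  assumes "copies s x \<le> 1" "(x, v) \<in># store s" "(x, w) \<in># store s"
  shows "v = w"
proof -
  obtain N where N: "store s = add_mset (x, v) N"
    using assms(2) by (blast dest: multi_member_split)
  then have "{#e \<in># N. fst e = x#} = {#}"
    using assms(1) by (simp add: copies_def)
  then have "(x, w) \<notin># N"
    by (auto simp: filter_mset_eq_conv)
  with N assms(3) show ?thesis by simp
qed

lemma view_mem: "copies s x \<le> 1 \<Longrightarrow> (x, v) \<in># store s \<Longrightarrow> checkpoint_view s x = v"
  unfolding checkpoint_view_def stored_def using copy_unique by (smt (verit, best) theI_unique)

text \<open>Lazy copying acts only on objects without a copy, and execution replaces the copies of
  its keys by exactly one each. The second inequality is what keeps stored objects stored.\<close>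

lemma copies_step:
  fixes s :: "('tx, 'obj::finite, 'val) state"
  assumes r: "reachable Sys s" and st: "step Sys s a t" and "copies s x \<le> 1"
  shows "copies t x \<le> 1 \<and> copies s x \<le> copies t x"
  using r st
proof (cases rule: checkpoint_step)
  case stay
  then show ?thesis using assms copies_cong by (metis order_refl)
next
  case (copy y)
  then have "copies t x = copies s x + (if x = y then 1 else 0)"
    by (simp add: copies_def)
  then show ?thesis using copy assms by (auto simp: stored_iff)
next
  case (exec i j T c)
  then show ?thesis
    using exec_on_checkpoint_copies[of Sys T s x] copies_cong[OF exec(3)] assms by auto
qed

lemma copies_le:
  fixes s :: "('tx, 'obj::finite, 'val) state"
  shows "reachable Sys s \<Longrightarrow> copies s x \<le> 1"
proof (induction rule: reachable_induct)
  case init then show ?case by (simp add: init_state_def copies_def)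
next
  case (step s a t)
  then show ?case using copies_step by blast
qed

lemma stored_after_recording:
  fixes s :: "('tx, 'obj::finite, 'val) state"
  shows "reachable Sys s \<Longrightarrow> red1 s \<Longrightarrow> kpc s \<noteq> KRecord \<Longrightarrow> stored s x"
proof (induction rule: reachable_induct)
  case init then show ?case by (simp add: init_state_def red1_def)
next
  case (step s a t)
  have "stored s x"
    using step.hyps(2)
  proof cases
    case recorded then show ?thesis by blast
  qed (use step.IH step.prems in \<open>auto simp: effect_defs red1_def split: if_splits\<close>)
  then show ?case
    using copies_step[OF step.hyps copies_le[OF step.hyps(1), of x]] by (simp add: stored_iff)
qed

lemma view_stay:
  assumes "store t = store s" "base t = base s"
  shows "checkpoint_view t = checkpoint_view s"
  using assms stored_cong[OF assms(1)] by (auto simp: checkpoint_view_def fun_eq_iff)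

lemma view_copy:
  assumes "\<not> stored s x" "store t = add_mset (x, base s x) (store s)" "base t = base s"
  shows "checkpoint_view t = checkpoint_view s"
  using assms by (auto simp: checkpoint_view_def stored_def fun_eq_iff)

text \<open>Only the keys are rewritten; elsewhere the transaction acts as the identity, so objects
  still read from \<open>base\<close> are right as well.\<close>

lemma view_exec:
  fixes s :: "('tx, 'obj::finite, 'val) state"
  assumes "replicated_database Sys" "store t = store (exec_on_checkpoint Sys T s)" "base t = base s"
  shows "checkpoint_view t = apply_tx Sys T (checkpoint_view s)"
proof
  fix x
  have *: "(x, v) \<in># store t \<longleftrightarrow>
    (if x \<in> keys Sys T then v = apply_tx Sys T (checkpoint_view s) x else (x, v) \<in># store s)" for v
    using exec_on_checkpoint_mem[of x v Sys T s] assms(2) by simp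
  show "checkpoint_view t x = apply_tx Sys T (checkpoint_view s) x"
  proof (cases "x \<in> keys Sys T")
    case True
    then show ?thesis by (simp add: checkpoint_view_def[of t] stored_def *)
  next
    case False
    then have "checkpoint_view t x = checkpoint_view s x"
      using assms(3) by (simp add: checkpoint_view_def stored_def *)
    then show ?thesis
      using assms(1) False by (simp add: replicated_database_def)
  qed
qed

text \<open>At the switch the store is empty and the view is \<open>base\<close>, the committed
  state of R1. Copying leaves the view unchanged, and each execution appends one new transaction to
  the enumeration.\<close>

lemma view_cp_set:
  fixes s :: "('tx, 'obj::finite, 'val) state"
  assumes db: "replicated_database Sys"
  shows "reachable Sys s \<Longrightarrow> red1 s \<Longrightarrow>
    \<exists>xs. distinct xs \<and> set xs = cp_set s \<and> checkpoint_view s = db_after Sys xs"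
proof (induction rule: reachable_induct)
  case init then show ?case by (simp add: init_state_def red1_def)
next
  case (step s a t)
  note r = step.hyps(1) and st = step.hyps(2)
  show ?case
  proof (cases "red1 s")
    case False
    then have q: "store s = {#}" "cp_exec s = {}" "\<And>i j. quiet_receiver (rpc s (i, j))"
      using quiet_before_red[OF r False] unfolding quiet_def by blast+
    have "store t = {#} \<and> cp_exec t = {}"
      using r st
    proof (cases rule: checkpoint_step)
      case (exec i j T c)
      then show ?thesis using q(3)[of i j] by simp
    qed (use q False in auto)
    moreover have "cut t = committed_at s 1" "base t = db s 1"
      using cut_step[OF st] False step.prems by simp_all
    ultimately have "cp_set t = committed_at s 1" "checkpoint_view t = db s 1"
      by (auto simp: cp_set_def checkpoint_view_def stored_def)
    then show ?thesis using db_committed[OF r, of 1] by simp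
  next
    case True
    then obtain xs where xs: "distinct xs" "set xs = cp_set s" "checkpoint_view s = db_after Sys xs"
      using step.IH by blast
    have cut: "cut t = cut s" "base t = base s"
      using cut_step[OF st] True by simp_all
    show ?thesis
      using r st
    proof (cases rule: checkpoint_step)
      case stay
      then show ?thesis
        using xs cut view_stay[of t s] by (intro exI[of _ xs]) (simp add: cp_set_def)
    next
      case (copy x)
      then show ?thesis
        using xs cut view_copy[of s x t] by (intro exI[of _ xs]) (simp add: cp_set_def)
    next
      case (exec i j T c)
      have "T \<notin> cp_set s"
        using exec_committed[OF r, of T] ckpt_origin[OF r exec(1)] exec(1) by (auto simp: cp_set_def)
      then show ?thesis
        using xs cut view_exec[OF db exec(3) cut(2)] exec(4)
        by (intro exI[of _ "xs @ [T]"]) (auto simp: cp_set_def db_after_def)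
    qed
  qed
qed

section \<open>Message counters and termination\<close>

text \<open>What R1 committed before the switch is in the cut. A later commit of an early
  transaction comes from a message that is not Red, and this leads to \<open>RCkpt\<close>, from
  where it can only enter \<open>cp_exec\<close>.\<close>

lemma early_executed:
  "reachable Sys s \<Longrightarrow> red1 s \<Longrightarrow> Tx T \<in> set (clog s 1) \<Longrightarrow> origin Sys T \<noteq> 1 \<Longrightarrow> early Sys s T \<Longrightarrow>
   T \<in> cp_set s \<or> (\<exists>c. rpc s (1, origin Sys T) = RCkpt T c)"
proof (induction rule: reachable_induct)
  case init then show ?case by (simp add: init_state_def red1_def)
next
  case (step s a t)
  note r = step.hyps(1) and st = step.hyps(2)
  show ?case
  proof (cases "Tx T \<in> set (clog s 1)")
    case True
    then have early: "early Sys s T"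
      using early_stable[OF r st clog_origin[OF r]] step.prems by blast
    show ?thesis
    proof (cases "red1 s")
      case False
      then show ?thesis
        using cut_step[OF st] step.prems True by (simp add: cp_set_def committed_at_def)
    next
      case red: True
      have sub: "cp_set s \<subseteq> cp_set t"
        using r st by (cases rule: checkpoint_step) (use cut_step[OF st] red in \<open>auto simp: cp_set_def\<close>)
      have "rpc t (1, origin Sys T) = RCkpt T c \<or> T \<in> cp_exec t"
        if "rpc s (1, origin Sys T) = RCkpt T c" for c
        using st that
        by cases (((simp add: effect_defs; fail) | (auto simp: effect_defs split: if_splits))[1])+
      then show ?thesis
        using sub step.IH[OF red True step.prems(3) early] by (auto simp: cp_set_def)
    qed
  next
    case False
    from st step.prems(2) False show ?thesis
    proof (cases rule: commit_step)
      case local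
      then show ?thesis using client_origin[OF r] step.prems(3) by blast
    next
      case (remote j c)
      have j: "origin Sys T = j" using exec_origin[OF r remote(1)] by blast
      have "c \<noteq> Red"
        using message_color[OF r in_flight_receiver[OF remote(1)]] exec_origin[OF r remote(1)]
          early_stable[OF r st, of T] step.prems(3,4) by auto
      \<comment> \<open>The step that turns R1 Red changes no log, so a commit that ends in a Red
        state also starts in one.\<close>
      moreover have "rcolor s 1 = Red"
      proof (rule ccontr)
        assume "rcolor s 1 \<noteq> Red"
        then have "clog t = clog s"
          using initiator_red[OF r] cut_step[OF st] step.prems(1) by (simp split: if_splits)
        then show False using step.prems(2) False by simp
      qed
      ultimately show ?thesis using remote j by simp
    qed
  qed
qed

definition received :: "('tx, 'obj, 'val) system \<Rightarrow> ('tx, 'obj, 'val) state \<Rightarrow> replica \<Rightarrow> 'tx set" where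
  "received Sys s j = {T. origin Sys T = j \<and> Tx T \<in> set (clog s 1) \<and> early Sys s T}"

lemma finite_txs: "finite {T. P T \<and> Tx T \<in> set xs \<and> Q T}"
proof -
  have "finite (Tx -` set xs)"
    by (rule finite_vimageI) (auto simp: inj_def)
  then show ?thesis by (rule rev_finite_subset) auto
qed

text \<open>For \<open>j\<close> other than 1 a message is not Red iff its transaction is early, so
  exactly the early ones pass through \<open>RCount\<close>. The extra unit is the one committed but
  not yet counted.\<close>

lemma recv_count_eq:
  "reachable Sys s \<Longrightarrow> j \<noteq> 1 \<Longrightarrow>
   recv_count s j + (if after_commit (rpc s (1, j)) then 1 else 0) = card (received Sys s j)"
proof (induction rule: reachable_induct)
  case init then show ?case by (simp add: init_state_def received_def)
next
  case (step s a t)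
  note r = step.hyps(1) and st = step.hyps(2)
  note IH = step.IH[OF step.prems]
  have stable: "early Sys t T = early Sys s T" if "Tx T \<in> set (clog s 1)" for T
    using early_stable[OF r st clog_origin[OF r that]] .
  have fin: "finite (received Sys s j)"
    unfolding received_def by (rule finite_txs)
  show ?case
  proof (cases "\<exists>T. Tx T \<in> set (clog t 1) \<and> Tx T \<notin> set (clog s 1)")
    case False
    obtain ys where "clog t 1 = clog s 1 @ ys"
      using clog_extends[OF st] by blast
    with False have "received Sys t j = received Sys s j"
      using stable by (auto simp: received_def)
    moreover have "recv_count t j + (if after_commit (rpc t (1, j)) then 1 else 0) =
      recv_count s j + (if after_commit (rpc s (1, j)) then 1 else 0)"
      using st
    proof cases
      case (commit_remote i k T c)
      then show ?thesis using False exec_fresh[OF r, of i k T c] by (auto simp: effect_defs)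
    next
      case (count i k T c)
      then show ?thesis using after_commit_initiator[OF r, of i k T] by auto
    qed (((simp add: effect_defs; fail) | (auto simp: effect_defs split: if_splits))[1])+
    ultimately show ?thesis using IH by simp
  next
    case True
    then obtain T where T: "Tx T \<in> set (clog t 1)" "Tx T \<notin> set (clog s 1)" by blast
    have rec: "received Sys t j = received Sys s j \<union> (if origin Sys T = j \<and> early Sys t T then {T} else {})"
      if "clog t = (clog s)(1 := clog s 1 @ [Tx T])"
      using that stable by (auto simp: received_def)
    from st T show ?thesis
    proof (cases rule: commit_step)
      case local
      then have "origin Sys T \<noteq> j" using client_origin[OF r] step.prems by blast
      with local rec IH show ?thesis by simp
    next
      case (remote k c)
      have k: "origin Sys T = k" "k \<noteq> 1" "early Sys t T \<longleftrightarrow> c \<noteq> Red"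
        using message_color[OF r in_flight_receiver[OF remote(1)]] exec_origin[OF r remote(1)]
          early_stable[OF r st, of T] by auto
      have "T \<notin> received Sys s j" using T by (simp add: received_def)
      then show ?thesis
        using remote rec IH k fin by auto
    qed
  qed
qed

definition sent_early :: "('tx, 'obj, 'val) system \<Rightarrow> replica \<Rightarrow> 'tx entry list \<Rightarrow> 'tx set" where
  "sent_early Sys j xs = {T. origin Sys T = j \<and> Tx T \<in> set (pre xs)}"

lemma finite_sent_early [simp]: "finite (sent_early Sys j xs)"
  using finite_txs[of "\<lambda>T. origin Sys T = j" "pre xs" "\<lambda>_. True"] by (simp add: sent_early_def)

lemma sent_early_append: "CpLog \<in> set xs \<Longrightarrow> sent_early Sys j (xs @ ys) = sent_early Sys j xs"
  by (simp add: sent_early_def pre_append)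

fun uncounted :: "'tx sender_pc \<Rightarrow> nat" where
  "uncounted (SRead T) = 1"
| "uncounted (SAppend T) = 1"
| "uncounted (SColor T) = 1"
| "uncounted _ = 0"

text \<open>Until the first CpLog is read, every local transaction fetched is early;
  \<open>uncounted\<close> covers the one fetched but not yet counted. Later the counter also counts
  Red messages, hence the restriction; \<open>SReply\<close> is the moment when its value is
  sent.\<close>

lemma sent_count_eq:
  "reachable Sys s \<Longrightarrow> j \<noteq> 1 \<Longrightarrow> curr_color s j \<noteq> Red \<or> spc s j = SReply \<Longrightarrow>
   sent_count s j + uncounted (spc s j) = card (sent_early Sys j (take (log_pos s j) (clog s j)))"
proof (induction rule: reachable_induct)
  case init then show ?case by (simp add: init_state_def sent_early_def)
next
  case (step s a t)
  note r = step.hyps(1) and st = step.hyps(2)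
  note ok = sender_colors[OF r, of j]
  have once: "count_list (clog s j) (Tx T) \<le> 1" for T
    by (rule commit_once[OF r])
  have *: "sent_count t j + uncounted (spc t j) = card (sent_early Sys j (take (log_pos t j) (clog s j)))"
    using step_sender_step[OF st, of j]
  proof cases
    case (fetch_tx T)
    let ?xs = "clog s j" and ?n = "log_pos s j"
    have cp: "CpLog \<notin> set (take ?n ?xs)"
      using ok fetch_tx step.prems by (auto simp: sender_ok_def split: if_splits)
    have split: "?xs = take ?n ?xs @ Tx T # drop (Suc ?n) ?xs"
      using fetch_tx id_take_nth_drop[of ?n ?xs] by simp
    have "count_list (take ?n ?xs @ Tx T # drop (Suc ?n) ?xs) (Tx T) \<le> 1"
      using once[of T] split by simp
    then have "T \<notin> sent_early Sys j (take ?n ?xs)"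
      using set_pre_subset[of "take ?n ?xs"] by (auto simp: count_list_0_iff sent_early_def)
    moreover have "sent_early Sys j (take (Suc ?n) ?xs) =
        sent_early Sys j (take ?n ?xs) \<union> (if origin Sys T = j then {T} else {})"
      using fetch_tx cp by (auto simp: sent_early_def take_Suc_conv_app_nth pre_append pre_Cons pre_id)
    ultimately show ?thesis
      using fetch_tx step.IH[OF step.prems(1)] step.prems(2)
      by (auto split: if_splits)
  next
    case fetch_cplog
    then have "sent_early Sys j (take (log_pos t j) (clog s j)) = sent_early Sys j (take (log_pos s j) (clog s j))"
      by (auto simp: sent_early_def take_Suc_conv_app_nth pre_append pre_Cons pre_id)
    then show ?thesis using fetch_cplog step.IH[OF step.prems(1)] step.prems(2) by auto
  next
    case (append T)
    then show ?thesis using step.IH[OF step.prems(1)] step.prems ok by (auto split: if_splits)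
  next
    case set_red
    then show ?thesis using step.IH[OF step.prems(1)] ok by (auto simp: sender_ok_def split: if_splits)
  qed (use step.IH[OF step.prems(1)] step.prems in \<open>auto split: if_splits\<close>)
  have "log_pos t j \<le> length (clog s j)"
    using step_sender_step[OF st, of j] log_pos_le[OF r, of j] by cases auto
  moreover obtain ys where "clog t j = clog s j @ ys"
    using clog_extends[OF st] by blast
  ultimately show ?case using * by simp
qed

lemma sent_early_stable:
  assumes "step Sys s a t" "CpLog \<in> set (clog s j)"
  shows "CpLog \<in> set (clog t j) \<and> sent_early Sys j (clog t j) = sent_early Sys j (clog s j)"
proof -
  obtain ys where "clog t j = clog s j @ ys"
    using clog_extends[OF assms(1)] by blast
  then show ?thesis using assms(2) by (simp add: sent_early_append)
qed

text \<open>The number is computed from the part of the log read so far. That part contains a CpLog,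
  so the whole log, now and later, has the same \<open>sent_early\<close>.\<close>

lemma reply_count:
  "reachable Sys s \<Longrightarrow> c \<in># reply_chan s j \<or> replies s j = Some c \<Longrightarrow>
   j \<noteq> 1 \<and> CpLog \<in> set (clog s j) \<and> c = card (sent_early Sys j (clog s j))"
proof (induction rule: reachable_induct)
  case init then show ?case by (simp add: init_state_def)
next
  case (step s a t)
  note r = step.hyps(1) and st = step.hyps(2)
  have "(c \<in># reply_chan s j \<or> replies s j = Some c) \<or> (spc s j = SReply \<and> c = sent_count s j)"
    using st step.prems
    by cases (((simp add: effect_defs; fail) | (auto simp: effect_defs split: if_splits dest: in_diffD))[1])+
  moreover have "j \<noteq> 1 \<and> CpLog \<in> set (clog s j) \<and> c = card (sent_early Sys j (clog s j))"
    if p: "spc s j = SReply" "c = sent_count s j"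
  proof -
    have j: "j \<noteq> 1" using p initiator_pcs[OF r] by blast
    have cp: "CpLog \<in> set (take (log_pos s j) (clog s j))"
      using sender_colors[OF r, of j] p by (auto simp: sender_ok_def)
    then have "sent_early Sys j (clog s j) = sent_early Sys j (take (log_pos s j) (clog s j))"
      using sent_early_append[OF cp, of Sys j "drop (log_pos s j) (clog s j)"] by simp
    then show ?thesis
      using sent_count_eq[OF r j] p j cp by (auto dest: in_set_takeD)
  qed
  ultimately have "j \<noteq> 1 \<and> CpLog \<in> set (clog s j) \<and> c = card (sent_early Sys j (clog s j))"
    using step.IH by blast
  then show ?case using sent_early_stable[OF st, of j] by simp
qed

lemma replies_recorded:
  "reachable Sys s \<Longrightarrow> kpc s = KCounters \<or> kpc s = KDone \<Longrightarrow> j \<in> replicas Sys - {1} \<Longrightarrow> replies s j \<noteq> None"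
proof (induction rule: reachable_induct)
  case init then show ?case by (simp add: init_state_def)
next
  case (step s a t)
  from step.hyps(2) show ?case
  proof cases
    case replies_received
    then show ?thesis using step.prems by auto
  qed (use step.IH step.prems in \<open>auto simp: effect_defs split: if_splits\<close>)
qed

lemma cp_set_step:
  assumes r: "reachable Sys s" and st: "step Sys s a t" and "red1 s"
  shows "cp_set s \<subseteq> cp_set t"
  using r st by (cases rule: checkpoint_step) (use cut_step[OF st] assms(3) in \<open>auto simp: cp_set_def\<close>)

text \<open>At \<open>Finish\<close>, \<open>recv_count\<close> equals the size of
  \<open>sent_early\<close>, while \<open>recv_count\<close> plus the pending unit is the size of
  its subset \<open>received\<close>. So nothing is pending and the two sets coincide. Afterwards
  \<open>sent_early\<close> is frozen, since a reply presupposes a CpLog.\<close>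

lemma finished_complete:
  "reachable Sys s \<Longrightarrow> kpc s = KDone \<Longrightarrow> j \<in> replicas Sys - {1} \<Longrightarrow> sent_early Sys j (clog s j) \<subseteq> cp_set s"
proof (induction rule: reachable_induct)
  case init then show ?case by (simp add: init_state_def)
next
  case (step s a t)
  note r = step.hyps(1) and st = step.hyps(2)
  show ?case
  proof (cases "kpc s = KDone")
    case True
    obtain c where "replies s j = Some c"
      using replies_recorded[OF r _ step.prems(2)] True by auto
    then have "CpLog \<in> set (clog s j)"
      using reply_count[OF r] by blast
    moreover have "cp_set s \<subseteq> cp_set t"
      using cp_set_step[OF r st] True by (simp add: red1_def)
    ultimately show ?thesis
      using step.IH[OF True step.prems(2)] sent_early_stable[OF st] by blast
  next
    case False
    have t: "kpc s = KCounters \<and> replies s j = Some (recv_count s j) \<and> cp_set t = cp_set s \<and> clog t = clog s"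
      using st step.prems(1) False
    proof cases
      case finish
      then show ?thesis using step.prems(2) by (simp add: cp_set_def)
    qed (((simp add: effect_defs split: if_splits; fail))[1])+
    have j: "j \<noteq> 1" using step.prems(2) by simp
    have sub: "received Sys s j \<subseteq> sent_early Sys j (clog s j)"
      using j by (auto simp: received_def sent_early_def early_def)
    have "recv_count s j = card (sent_early Sys j (clog s j))"
      using reply_count[OF r] t by blast
    moreover have "card (received Sys s j) \<le> card (sent_early Sys j (clog s j))"
      using sub by (intro card_mono) auto
    ultimately have eq: "card (received Sys s j) = card (sent_early Sys j (clog s j))"
      and idle: "\<not> after_commit (rpc s (1, j))"
      using recv_count_eq[OF r j] by (auto split: if_splits)
    have "received Sys s j = sent_early Sys j (clog s j)"
      using card_subset_eq[OF _ sub eq] by simp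
    moreover have "received Sys s j \<subseteq> cp_set s"
    proof
      fix T assume T: "T \<in> received Sys s j"
      have "red1 s" using t by (simp add: red1_def)
      then have "T \<in> cp_set s \<or> (\<exists>c. rpc s (1, j) = RCkpt T c)"
        using early_executed[OF r, of T] T j by (auto simp: received_def)
      then show "T \<in> cp_set s" using idle by auto
    qed
    ultimately show ?thesis using t by simp
  qed
qed

lemma cp_set_early:
  assumes "reachable Sys s" "red1 s" "T \<in> cp_set s"
  shows "early Sys s T \<and> Tx T \<in> set (clog s 1) \<and> (origin Sys T = 1 \<longrightarrow> T \<in> cut s)"
  using assms cut_early[of Sys s T] cut_committed[of Sys s T] exec_committed[of Sys s T] by (auto simp: cp_set_def)

section \<open>Properties of the finished checkpoint\<close>

lemma mem_take_unique:
  assumes "count_list xs x \<le> 1" "x \<in> set (take m xs)" "q < length xs" "xs ! q = x"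
  shows "q < m"
proof (rule ccontr)
  assume "\<not> q < m"
  then have "drop m xs ! (q - m) = x" "q - m < length (drop m xs)"
    using assms(3,4) by simp_all
  then have "x \<in> set (drop m xs)"
    by (metis nth_mem)
  then have "count_list (drop m xs) x \<noteq> 0" "count_list (take m xs) x \<noteq> 0"
    using assms(2) by (simp_all add: count_list_0_iff)
  moreover have "count_list (take m xs) x + count_list (drop m xs) x = count_list xs x"
    by (metis append_take_drop_id count_list_append)
  ultimately show False using assms(1) by linarith
qed

lemma finished_dependency_closure:
  assumes r: "reachable Sys s" and fin: "finished s"
  shows "dependency_closure Sys s"
  unfolding dependency_closure_def
proof (intro allI impI, elim conjE)
  fix T U i
  assume T: "T \<in> cp_set s" "origin Sys T = i" and cb: "committed_before s i U T"
  have kd: "kpc s = KDone" and red: "red1 s"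
    using fin by (simp_all add: finished_def red1_def)
  obtain p q where pq: "p < q" "q < length (clog s i)" "clog s i ! p = Tx U" "clog s i ! q = Tx T"
    using cb unfolding committed_before_def by blast
  \<comment> \<open>Applied to two prefixes: the local cut if \<open>i = 1\<close>, the entries
    before the first CpLog otherwise.\<close>
  have prefix: "Tx U \<in> set (take m (clog s i))" if "Tx T \<in> set (take m (clog s i))" for m
  proof -
    have "q < m"
      using mem_take_unique[OF commit_once[OF r] that pq(2,4)] .
    with pq show ?thesis
      by (auto simp: in_set_conv_nth intro!: exI[of _ p])
  qed
  show "U \<in> cp_set s"
  proof (cases "i = 1")
    case True
    obtain m where "cut s = {T. Tx T \<in> set (take m (clog s 1))}"
      using cut_prefix[OF r red] by blast
    then show ?thesis
      using cp_set_early[OF r red T(1)] T(2) prefix[of m] True by (auto simp: cp_set_def)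
  next
    case False
    have "Tx T \<in> set (pre (clog s i))"
      using cp_set_early[OF r red T(1)] T(2) False by (simp add: early_def)
    then have "Tx U \<in> set (pre (clog s i))"
      using prefix[of "length (pre (clog s i))"] unfolding pre_def by (metis takeWhile_eq_take)
    then have e: "early Sys s U"
      using pre_early[OF r False] by blast
    have U: "Tx U \<in> set (clog s (origin Sys U))"
      using clog_origin[OF r, of U i] pq by (metis nth_mem order.strict_trans)
    show ?thesis
    proof (cases "origin Sys U = 1")
      case True
      then show ?thesis using e red by (simp add: early_def cp_set_def)
    next
      case False
      then show ?thesis
        using e finished_complete[OF r kd, of "origin Sys U"] clog_replicas[OF r U]
        by (auto simp: early_def sent_early_def)
    qed
  qed
qed

lemma finished_dirty_write_exclusion:
  fixes s :: "('tx, 'obj::finite, 'val) state"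
  assumes db: "replicated_database Sys" and r: "reachable Sys s" and fin: "finished s"
  shows "dirty_write_exclusion Sys s"
proof -
  have red: "red1 s" and k: "kpc s \<noteq> KRecord"
    using fin by (simp_all add: finished_def red1_def)
  obtain ys where ys: "distinct ys" "set ys = cp_set s" "checkpoint_view s = db_after Sys ys"
    using view_cp_set[OF db r red] by blast
  have "(x, v) \<in># store s \<longleftrightarrow> v = db_after Sys xs x" if xs: "distinct xs \<and> set xs = cp_set s" for xs x v
  proof -
    \<comment> \<open>Order independence enters here, turning the enumeration found by the invariant
      into an arbitrary one.\<close>
    have eq: "db_after Sys xs = checkpoint_view s"
      using db xs ys unfolding replicated_database_def by metis
    obtain w where "(x, w) \<in># store s"
      using stored_after_recording[OF r red k, of x] by (auto simp: stored_def)
    then show ?thesis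
      using view_mem[OF copies_le[OF r]] eq by metis
  qed
  moreover have "finite (cp_set s)"
    using ys(2) by (metis List.finite_set)
  moreover have "T \<in> committed_at s (origin Sys T)" if "T \<in> cp_set s" for T
    using cp_set_early[OF r red that] clog_origin[OF r, of T 1] by (simp add: committed_at_def)
  ultimately show ?thesis
    unfolding dirty_write_exclusion_def by blast
qed

lemma finished_copies:
  fixes s :: "('tx, 'obj::finite, 'val) state"
  assumes r: "reachable Sys s" and fin: "finished s"
  shows "copies s x = 1"
proof -
  have "stored s x"
    using stored_after_recording[OF r] fin by (simp add: finished_def red1_def)
  then show ?thesis
    using copies_le[OF r, of x] by (simp add: stored_iff)
qed

section \<open>Overhead\<close>

lemma init_reachable: "run Sys (init_state Sys) as s \<Longrightarrow> reachable Sys s"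
  unfolding reachable_def by blast

lemma run_append: "run Sys t bs u \<Longrightarrow> run Sys s as t \<Longrightarrow> run Sys s (as @ bs) u"
proof (induction rule: run.induct)
  case (run_snoc bs u a v)
  then show ?case using run.run_snoc[of Sys s "as @ bs" u a v] by simp
qed simp

lemma recency_run:
  assumes "run Sys s as t" "A \<subseteq> committed_at s 1" "\<not> red1 s"
  shows "A \<subseteq> committed_at t 1 \<and> (red1 t \<longrightarrow> A \<subseteq> cut t)"
  using assms
proof (induction rule: run.induct)
  case (run_snoc as t a u)
  obtain ys where "clog u 1 = clog t 1 @ ys"
    using clog_extends[OF run_snoc.hyps(2)] by blast
  then have "committed_at t 1 \<subseteq> committed_at u 1"
    by (auto simp: committed_at_def)
  then show ?case
    using run_snoc cut_step[OF run_snoc.hyps(2)] by (auto split: if_splits)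
qed simp

section \<open>Number of control messages\<close>

fun pending_requests :: "('tx, 'obj, 'val) system \<Rightarrow> checkpoint_pc \<Rightarrow> replica set" where
  "pending_requests Sys (KRequest J) = J"
| "pending_requests Sys KReplies = {}"
| "pending_requests Sys KCounters = {}"
| "pending_requests Sys KDone = {}"
| "pending_requests Sys _ = replicas Sys - {1}"

text \<open>Once Red, a MessageSender never reaches \<open>SReply\<close> again, so a replica enters
  this set with its only reply and stays there.\<close>

definition replied :: "('tx, 'obj, 'val) system \<Rightarrow> ('tx, 'obj, 'val) state \<Rightarrow> replica set" where
  "replied Sys s = {i \<in> replicas Sys - {1}. rcolor s i = Red \<and> spc s i \<noteq> SReply}"

lemma finite_replicas [simp]: "finite (replicas Sys)"
  by (simp add: replicas_def)

lemma pending_requests_step: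
  assumes r: "reachable Sys s" and st: "step Sys s a t"
  shows "card (pending_requests Sys (kpc t)) + (if \<exists>i. a = SendRequest i then 1 else 0)
    \<le> card (pending_requests Sys (kpc s))"
  using st
proof cases
  case (send_request J j)
  have "finite J"
    using initiator_pcs[OF r] send_request by (meson finite_Diff finite_replicas finite_subset)
  then have "card J > 0" "card (J - {j}) = card J - 1"
    using send_request by (auto simp: card_gt_0_iff)
  then show ?thesis using send_request by simp
qed (((simp add: effect_defs; fail) | (auto simp: effect_defs split: if_splits))[1])+

lemma replied_step:
  assumes r: "reachable Sys s" and st: "step Sys s a t"
  shows "replied Sys s \<subseteq> replied Sys t"
proof
  fix i assume i: "i \<in> replied Sys s"
  then have "rcolor t i = Red"
    using rcolor_step[OF st, of i] by (auto simp: replied_def split: if_splits)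
  moreover have "spc t i \<noteq> SReply"
    using step_sender_step[OF st, of i] i sender_colors[OF r, of i]
    by cases (auto simp: replied_def sender_ok_def)
  ultimately show "i \<in> replied Sys t"
    using i by (auto simp: replied_def)
qed

lemma send_reply_step:
  assumes r: "reachable Sys s" and st: "step Sys s (SendReply i) t"
  shows "i \<in> replied Sys t - replied Sys s"
proof -
  have s: "spc s i = SReply" "spc t i = SIdle" "rcolor t i = rcolor s i"
    using st by (cases; simp)+
  then have "i \<noteq> 1" "i \<in> replicas Sys"
    using initiator_pcs[OF r] sender_origin[OF r, of i] by auto
  then show ?thesis
    using s sender_colors[OF r, of i] by (auto simp: replied_def sender_ok_def)
qed

text \<open>A request is paid for by \<open>pending_requests\<close>, a reply by the growth of
  \<open>replied\<close>. Both are bounded by the number of replicas other than R1, which gives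
  twice that number in total.\<close>

lemma control_messages_run:
  "run Sys (init_state Sys) as s \<Longrightarrow>
   control_messages as + card (pending_requests Sys (kpc s)) \<le> card (replicas Sys - {1}) + card (replied Sys s)"
proof (induction rule: run.induct)
  case run_Nil
  then show ?case by (simp add: control_messages_def init_state_def)
next
  case (run_snoc as s a t)
  have r: "reachable Sys s" using run_snoc.hyps(1) by (rule init_reachable)
  have fin: "finite (replied Sys t)" by (simp add: replied_def)
  have "card (replied Sys s) + (if \<exists>i. a = SendReply i then 1 else 0) \<le> card (replied Sys t)"
  proof (cases "\<exists>i. a = SendReply i")
    case True
    then obtain i where "i \<in> replied Sys t - replied Sys s"
      using send_reply_step[OF r] run_snoc.hyps(2) by blast
    then have "replied Sys s \<subset> replied Sys t"
      using replied_step[OF r run_snoc.hyps(2)] by blast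
    then have "card (replied Sys s) < card (replied Sys t)"
      by (rule psubset_card_mono[OF fin])
    with True show ?thesis by simp
  next
    case False
    then show ?thesis using card_mono[OF fin replied_step[OF r run_snoc.hyps(2)]] by presburger
  qed
  moreover have "control_messages (as @ [a]) = control_messages as +
    (if \<exists>i. a = SendRequest i then 1 else 0) + (if \<exists>i. a = SendReply i then 1 else 0)"
    by (cases a) (auto simp: control_messages_def)
  ultimately show ?case
    using pending_requests_step[OF r run_snoc.hyps(2)] run_snoc.IH by linarith
qed

lemma control_messages_le:
  assumes "run Sys (init_state Sys) as s" "nrep Sys \<ge> 1"
  shows "control_messages as \<le> 2 * nrep Sys - 2"
proof -
  have "card (replicas Sys - {1}) = nrep Sys - 1"
    using assms(2) by (simp add: replicas_def)
  moreover have "card (replied Sys s) \<le> card (replicas Sys - {1})"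
    by (rule card_mono) (auto simp: replied_def)
  ultimately show ?thesis
    using control_messages_run[OF assms(1)] assms(2) by linarith
qed

section \<open>Potentials for the added steps\<close>

abbreviation added :: "'tx work \<Rightarrow> ('tx, 'obj, 'val) action \<Rightarrow> bool" where
  "added w a \<equiv> \<not> database_step a \<and> work_of a = w"

lemma added_steps_potential:
  assumes "run Sys (init_state Sys) as s"
    and "\<And>s a t. reachable Sys s \<Longrightarrow> step Sys s a t \<Longrightarrow> f s + (if added w a then 1 else 0) \<le> (f t :: nat)"
  shows "added_steps w as \<le> f s"
  using assms(1)
proof (induction rule: run.induct)
  case (run_snoc as s a t)
  then show ?case
    using assms(2)[OF init_reachable[OF run_snoc.hyps(1)] run_snoc.hyps(2)]
    by (auto simp: added_steps_def split: if_splits)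
qed (simp add: added_steps_def)

lemma calc_used_le: "reachable Sys s \<Longrightarrow> calc_used s T \<le> calc_const Sys * card (keys Sys T)"
proof (induction rule: reachable_induct)
  case init then show ?case by (simp add: init_state_def)
next
  case (step s a t)
  from step.hyps(2) step.IH show ?case
    by cases (((simp add: effect_defs; fail) | (auto simp: effect_defs split: if_splits))[1])+
qed

lemma executing_added:
  assumes "run Sys (init_state Sys) as s"
  shows "added_steps (Executing i T) as \<le> calc_const Sys * card (keys Sys T)"
proof -
  have "added_steps (Executing i T) as \<le> calc_used s T"
  proof (rule added_steps_potential[OF assms])
    fix s a t assume "reachable Sys s" "step Sys s a t"
    from this(2) show "calc_used s T + (if added (Executing i T) a then 1 else 0) \<le> calc_used t T"
      by cases (((simp add: effect_defs; fail) | (auto simp: effect_defs split: if_splits entry.splits))[1])+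
  qed
  then show ?thesis
    using calc_used_le[OF init_reachable[OF assms], of T] by linarith
qed

text \<open>Progress of \<open>T\<close> through its at most three added steps; 3 is also the value
  after sending. A skipped \<open>SAppend\<close> is harmless, as the rank may grow by more than
  one.\<close>

definition sender_rank :: "'tx \<Rightarrow> 'tx entry list \<Rightarrow> 'tx sender_pc \<Rightarrow> nat \<Rightarrow> nat" where
  "sender_rank T xs p n =
     (if p = SRead T then 0 else if p = SAppend T then 1 else if p = SColor T then 2
      else if Tx T \<in> set (take n xs) then 3 else 0)"

lemma sender_rank_mono:
  assumes r: "reachable Sys s" and st: "step Sys s a t"
  shows "sender_rank T (clog s i) (spc s i) (log_pos s i) \<le> sender_rank T (clog t i) (spc t i) (log_pos t i)"
proof -
  have "log_pos t i \<le> length (clog s i)"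
    using step_sender_step[OF st, of i] log_pos_le[OF r, of i] by cases auto
  moreover obtain ys where "clog t i = clog s i @ ys"
    using clog_extends[OF st] by blast
  ultimately have "sender_rank T (clog t i) (spc t i) (log_pos t i) = sender_rank T (clog s i) (spc t i) (log_pos t i)"
    by (simp add: sender_rank_def)
  moreover have "sender_rank T (clog s i) (spc s i) (log_pos s i) \<le> sender_rank T (clog s i) (spc t i) (log_pos t i)"
    using step_sender_step[OF st, of i]
  proof cases
    case (fetch_tx U)
    \<comment> \<open>A second fetch of \<open>U\<close> would let its rank fall from 3 back to
      0.\<close>
    have "Tx U \<notin> set (take (log_pos s i) (clog s i))"
      using mem_take_unique[OF commit_once[OF r, of i U], of "log_pos s i" "log_pos s i"] fetch_tx by blast
    then show ?thesis using fetch_tx by (auto simp: sender_rank_def take_Suc_conv_app_nth)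
  next
    case (send U c)
    then show ?thesis using sender_origin[OF r, of i] by (auto simp: sender_rank_def)
  next
    case (color U)
    then show ?thesis using sender_origin[OF r, of i] by (auto simp: sender_rank_def)
  next
    case (read U)
    then show ?thesis using sender_origin[OF r, of i] by (auto simp: sender_rank_def)
  qed (auto simp: sender_rank_def take_Suc_conv_app_nth)
  ultimately show ?thesis by simp
qed

lemma sending_added:
  assumes "run Sys (init_state Sys) as s"
  shows "added_steps (Sending i T) as \<le> 3"
proof -
  have "added_steps (Sending i T) as \<le> sender_rank T (clog s i) (spc s i) (log_pos s i)"
  proof (rule added_steps_potential[OF assms])
    fix s a t assume r: "reachable Sys s" and st: "step Sys s a t"
    show "sender_rank T (clog s i) (spc s i) (log_pos s i) + (if added (Sending i T) a then 1 else 0)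
      \<le> sender_rank T (clog t i) (spc t i) (log_pos t i)"
    proof (cases "added (Sending i T) a")
      case True
      then have a: "a \<in> {ReadColor i T, SenderAppend i T, ColorMessage i T}"
        by (cases a rule: work_of.cases) auto
      from st a have p: "sender_tx (spc s i) = Some T \<and> (spc s i, spc t i) \<in> {SRead T} \<times> {SAppend T, SColor T} \<union>
         {(SAppend T, SColor T)} \<union> {SRead T, SColor T} \<times> range (SSend T) \<and> log_pos t i = log_pos s i"
        by cases (auto simp: effect_defs)
      have "Tx T \<in> set (take (log_pos s i) (clog s i))"
        using sender_origin[OF r, of i] p by blast
      moreover obtain ys where "clog t i = clog s i @ ys"
        using clog_extends[OF st] by blast
      ultimately show ?thesis using p True by (auto simp: sender_rank_def)
    next
      case False
      have "sender_rank T (clog s i) (spc s i) (log_pos s i) \<le> sender_rank T (clog t i) (spc t i) (log_pos t i)"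
        by (rule sender_rank_mono[OF r st])
      with False show ?thesis by auto
    qed
  qed
  then show ?thesis by (auto simp: sender_rank_def split: if_splits)
qed

lemma after_commit_committed:
  "reachable Sys s \<Longrightarrow> after_commit (rpc s (i, j)) \<Longrightarrow> receiver_msg (rpc s (i, j)) = Some (T, c) \<Longrightarrow> Tx T \<in> set (clog s i)"
proof (induction rule: reachable_induct)
  case init then show ?case by (simp add: init_state_def)
next
  case (step s a t)
  from step.hyps(2) step.IH step.prems show ?case
    by cases (((simp add: effect_defs; fail) | (auto simp: effect_defs split: if_splits))[1])+
qed

lemma count_committed: "reachable Sys s \<Longrightarrow> rpc s (i, j) = RCount T c \<Longrightarrow> Tx T \<in> set (clog s i)"
  using after_commit_committed[of Sys s i j T c] by simp

text \<open>The flag \<open>b\<close> (is \<open>T\<close> committed here?) tells a receiver that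
  has not met \<open>T\<close> from one that is done with it. The scale to 5 merges the path of R1,
  from \<open>RExec\<close> over \<open>RCkpt\<close> and \<open>RCount\<close>, with that of the
  others, from \<open>RTest1\<close> to \<open>RExec\<close>.\<close>

fun receiver_rank :: "'tx \<Rightarrow> bool \<Rightarrow> 'tx receiver_pc \<Rightarrow> nat" where
  "receiver_rank T b RIdle = (if b then 5 else 0)"
| "receiver_rank T b (RTest1 U c) = (if U = T then 0 else if b then 5 else 0)"
| "receiver_rank T b (RCas U c) = (if U = T then 1 else if b then 5 else 0)"
| "receiver_rank T b (RTest2 U c) = (if U = T then 1 else if b then 5 else 0)"
| "receiver_rank T b (RAppend U c) = (if U = T then 2 else if b then 5 else 0)"
| "receiver_rank T b (RExec U c) = (if U = T then 3 else if b then 5 else 0)"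
| "receiver_rank T b (RCkpt U c) = (if U = T then 3 else if b then 5 else 0)"
| "receiver_rank T b (RCount U c) = (if U = T then 4 else if b then 5 else 0)"

lemma receiver_rank_le: "receiver_rank T b p \<le> 5"
  by (cases p) auto

lemma receiver_rank_mono: "(b \<Longrightarrow> b') \<Longrightarrow> receiver_rank T b p \<le> receiver_rank T b' p"
  by (cases p) auto

lemma fetch_not_receiving: "work_of (Fetch k e) \<noteq> Receiving i j T"
  by (cases e) auto

text \<open>Token argument as in \<open>exec_fresh\<close>, with the token in the channel. It makes
  a receiver that takes up \<open>T\<close> start from rank 0.\<close>

lemma channel_fresh:
  assumes r: "reachable Sys s" and c: "(T, c) \<in># chan s (j, i)"
  shows "Tx T \<notin> set (clog s i)"
proof -
  have o: "origin Sys T = j" "i \<noteq> j" "i \<in> replicas Sys"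
    using in_flight_origin[OF r, of j i T c] c by (auto simp: in_flight_def)
  let ?xs = "clog s j" and ?n = "log_pos s j"
  have "count_list (take ?n ?xs) (Tx T) \<le> count_list (take ?n ?xs @ drop ?n ?xs) (Tx T)"
    unfolding count_list_append by simp
  then have "count_list (take ?n ?xs) (Tx T) \<le> 1"
    using commit_once[OF r, of j T] by simp
  moreover have "in_channel (chan s (j, i)) T > 0"
    unfolding in_channel_pos using c by (rule exI)
  moreover have "in_channel (chan s (j, i)) T + in_receiver (rpc s (i, j)) T + in_sender (spc s j) T +
      count_list (clog s i) (Tx T) = count_list (take ?n ?xs) (Tx T)"
    using message_tokens[OF r, of i T] unfolding o(1) using o(2,3) by blast
  ultimately have "count_list (clog s i) (Tx T) = 0"
    by linarith
  then show ?thesis by (simp add: count_list_0_iff)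
qed

lemma receiving_added:
  assumes "run Sys (init_state Sys) as s"
  shows "added_steps (Receiving i j T) as \<le> 5"
proof -
  have "added_steps (Receiving i j T) as \<le> receiver_rank T (Tx T \<in> set (clog s i)) (rpc s (i, j))"
  proof (rule added_steps_potential[OF assms])
    fix s a t assume r: "reachable Sys s" and st: "step Sys s a t"
    show "receiver_rank T (Tx T \<in> set (clog s i)) (rpc s (i, j)) + (if added (Receiving i j T) a then 1 else 0)
      \<le> receiver_rank T (Tx T \<in> set (clog t i)) (rpc t (i, j))"
      using st
      by cases (((simp add: effect_defs; fail) |
         (auto simp: effect_defs receiver_rank_mono fetch_not_receiving split: if_splits
            dest: channel_fresh[OF r] count_committed[OF r]))[1])+
  qed
  then show ?thesis
    by (rule order_trans[OF _ receiver_rank_le])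
qed

text \<open>Each receiver thread appends at most one CpLog: after success RColor is never Green
  again, which closes the way over \<open>RCas\<close>, and the second test checks the flag
  itself.\<close>

lemma append_success_color:
  "reachable Sys s \<Longrightarrow>
   (append_success s (i, j) \<or> (\<exists>T c. rpc s (i, j) = RAppend T c) \<longrightarrow> rcolor s i \<noteq> Green) \<and>
   (\<forall>T c. rpc s (i, j) = RCas T c \<or> rpc s (i, j) = RAppend T c \<longrightarrow> \<not> append_success s (i, j))"
proof (induction rule: reachable_induct)
  case init then show ?case by (simp add: init_state_def)
next
  case (step s a t)
  from step.hyps(2) step.IH show ?case
    by cases (((simp add: effect_defs; fail) | (auto simp: effect_defs split: if_splits))[1])+
qed

text \<open>\<open>SAppend\<close> is entered when RColor is Yellow and differs from
  \<open>curr_color\<close>; since the two agree about Red, \<open>curr_color\<close> must be Green.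
  Hence the sender appends at most once.\<close>

lemma sender_append_color:
  "reachable Sys s \<Longrightarrow> spc s i = SAppend T \<Longrightarrow> curr_color s i = Green \<and> rcolor s i \<noteq> Green"
proof (induction rule: reachable_induct)
  case init then show ?case by (simp add: init_state_def)
next
  case (step s a t)
  note r = step.hyps(1) and st = step.hyps(2)
  have i: "i \<noteq> 1"
    using initiator_pcs[OF reachable_step[OF r st]] step.prems by blast
  have "curr_color s i = Green \<or> curr_color s i = Yellow \<or> curr_color s i = Red"
    by (cases "curr_color s i") auto
  then show ?case
    using step_sender_step[OF st, of i] step.IH step.prems rcolor_step[OF st, of i] i sender_colors[OF r, of i]
    by (elim sender_step.cases) (auto split: if_splits)
qed

text \<open>The CPRequest for \<open>i\<close> not yet sent, in transit or being handled.\<close>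

definition request_tokens :: "checkpoint_pc \<Rightarrow> nat \<Rightarrow> control_pc \<Rightarrow> replica \<Rightarrow> nat" where
  "request_tokens k m p i =
     (if k \<in> {KIdle, KYellow, KRecord} \<or> (\<exists>J. k = KRequest J \<and> i \<in> J) then 1 else 0) + m +
     (if p = CIdle then 0 else 1)"

definition successful :: "('tx, 'obj, 'val) system \<Rightarrow> ('tx, 'obj, 'val) state \<Rightarrow> replica \<Rightarrow> replica set" where
  "successful Sys s i = {j \<in> replicas Sys. append_success s (i, j)}"

lemma successful_step:
  assumes "step Sys s a t"
  shows "successful Sys s i \<subseteq> successful Sys t i"
proof -
  have "append_success s (i, j) \<Longrightarrow> append_success t (i, j)" for j
    using assms by cases (((simp add: effect_defs; fail) | (auto simp: effect_defs))[1])+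
  then show ?thesis by (auto simp: successful_def)
qed

lemma request_tokens_step:
  assumes "step Sys s a t"
  shows "request_tokens (kpc t) (request_chan t i) (cpc t i) i + (if a = RequestAppend i then 1 else 0)
    \<le> request_tokens (kpc s) (request_chan s i) (cpc s i) i"
  using assms
  by cases (((simp add: effect_defs; fail) | (simp add: effect_defs request_tokens_def; fail) |
    (auto simp: effect_defs request_tokens_def))[1])+

lemma count_cplog_step:
  assumes "step Sys s a t"
  shows "count_list (clog t i) CpLog \<le> count_list (clog s i) CpLog +
    (if a = RequestAppend i \<or> (\<exists>T. a = SenderAppend i T) \<or> (\<exists>j T. a = ReceiverAppend i j T) then 1 else 0)"
  using assms by cases (((simp add: effect_defs; fail) | (auto simp: effect_defs))[1])+

text \<open>Every CpLog is paid for by a source that can be used once: the single CPRequest, the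
  departure of \<open>curr_color\<close> from Green, or the flag of one receiver thread.\<close>

lemma cplog_tokens:
  "reachable Sys s \<Longrightarrow>
   count_list (clog s i) CpLog + request_tokens (kpc s) (request_chan s i) (cpc s i) i \<le>
   card (successful Sys s i) + (if curr_color s i = Green then 0 else 1) + 1"
proof (induction rule: reachable_induct)
  case init then show ?case by (simp add: init_state_def request_tokens_def)
next
  case (step s a t)
  note r = step.hyps(1) and st = step.hyps(2)
  let ?green = "\<lambda>s. if curr_color s i = Green then 0 else 1 :: nat"
  have fin: "finite (successful Sys t i)"
    by (simp add: successful_def)
  have tokens: "request_tokens (kpc t) (request_chan t i) (cpc t i) i + (if a = RequestAppend i then 1 else 0)
    \<le> request_tokens (kpc s) (request_chan s i) (cpc s i) i"
    by (rule request_tokens_step[OF st])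
  have mono: "card (successful Sys s i) \<le> card (successful Sys t i)"
    by (rule card_mono[OF fin successful_step[OF st]])
  have green: "?green s \<le> ?green t"
    using step_sender_step[OF st, of i] sender_append_color[OF r, of i] by cases auto
  consider "a = RequestAppend i" | T where "a = SenderAppend i T" | j T where "a = ReceiverAppend i j T"
    | "count_list (clog t i) CpLog \<le> count_list (clog s i) CpLog"
    using count_cplog_step[OF st, of i] by (auto split: if_splits)
  then show ?case
  proof cases
    case 1
    then show ?thesis
      using count_cplog_step[OF st, of i] step.IH tokens mono green by simp
  next
    case (2 T)
    have "spc s i = SAppend T" "curr_color t i = rcolor s i"
      using st unfolding 2 by (cases, simp add: effect_defs)+
    then have "?green s + 1 \<le> ?green t"
      using sender_append_color[OF r] by simp
    then show ?thesis
      using count_cplog_step[OF st, of i] step.IH tokens mono 2 by simp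
  next
    case (3 j T)
    obtain c where c: "rpc s (i, j) = RAppend T c" and "append_success t (i, j)"
      using st unfolding 3 by cases (simp add: effect_defs)
    then have "j \<in> successful Sys t i - successful Sys s i"
      using append_success_color[OF r, of i j] append_origin[OF r c] by (auto simp: successful_def)
    then have "successful Sys s i \<subset> successful Sys t i"
      using successful_step[OF st] by blast
    then have "card (successful Sys s i) < card (successful Sys t i)"
      by (rule psubset_card_mono[OF fin])
    then show ?thesis
      using count_cplog_step[OF st, of i] step.IH tokens green 3 by simp
  next
    case 4
    then show ?thesis using step.IH tokens mono green by linarith
  qed
qed

lemma cplog_count:
  assumes "reachable Sys s"
  shows "count_list (clog s i) CpLog \<le> nrep Sys + 2"
proof -
  have "card (successful Sys s i) \<le> card (replicas Sys)"
    by (rule card_mono) (auto simp: successful_def)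
  then show ?thesis
    using cplog_tokens[OF assms, of i] by (simp add: replicas_def split: if_splits)
qed

text \<open>Reading a CpLog entry causes at most four steps; \<open>marking_left\<close> are those still to come.\<close>

fun marking_left :: "'tx sender_pc \<Rightarrow> nat" where
  "marking_left SCp = 3"
| "marking_left SSetRed = 2"
| "marking_left SReply = 1"
| "marking_left _ = 0"

definition marking_rank :: "('tx, 'obj, 'val) state \<Rightarrow> replica \<Rightarrow> nat" where
  "marking_rank s i = 4 * count_list (take (log_pos s i) (clog s i)) CpLog - marking_left (spc s i)"

text \<open>Keeps the subtraction in \<open>marking_rank\<close> from truncating: at the program
  points with steps left, at least one CpLog has been read.\<close>

lemma marking_left_le:
  assumes r: "reachable Sys s"
  shows "marking_left (spc s i) \<le> 3 * count_list (take (log_pos s i) (clog s i)) CpLog"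
proof (cases "marking_left (spc s i) = 0")
  case False
  then have "spc s i \<in> {SCp, SSetRed, SReply}"
    by (cases "spc s i") auto
  then have "CpLog \<in> set (take (log_pos s i) (clog s i))"
    using sender_colors[OF r, of i] by (auto simp: sender_ok_def take_Suc_conv_app_nth)
  then have "count_list (take (log_pos s i) (clog s i)) CpLog \<noteq> 0"
    by (simp add: count_list_0_iff)
  moreover have "marking_left (spc s i) \<le> 3"
    by (cases "spc s i") auto
  ultimately show ?thesis by linarith
qed simp

lemma marking_added:
  assumes "run Sys (init_state Sys) as s"
  shows "added_steps (Marking i) as \<le> 4 * (nrep Sys + 2)"
proof -
  have "added_steps (Marking i) as \<le> marking_rank s i"
  proof (rule added_steps_potential[OF assms])
    fix s a t assume r: "reachable Sys s" and st: "step Sys s a t"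
    have *: "marking_rank t i = 4 * count_list (take (log_pos t i) (clog s i)) CpLog - marking_left (spc t i)"
    proof -
      have "log_pos t i \<le> length (clog s i)"
        using step_sender_step[OF st, of i] log_pos_le[OF r, of i] by cases auto
      moreover obtain ys where "clog t i = clog s i @ ys"
        using clog_extends[OF st] by blast
      ultimately show ?thesis by (simp add: marking_rank_def)
    qed
    show "marking_rank s i + (if added (Marking i) a then 1 else 0) \<le> marking_rank t i"
    proof (cases "added (Marking i) a")
      case True
      then have a: "a \<in> {Fetch i CpLog, TestRed i, SetRed i, SendReply i}"
        by (cases a rule: work_of.cases) auto
      from st a have "spc s i = SIdle \<and> spc t i = SCp \<and> log_pos t i = Suc (log_pos s i) \<and>
            log_pos s i < length (clog s i) \<and> clog s i ! log_pos s i = CpLog \<or>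
          (spc s i, spc t i) \<in> {(SCp, SIdle), (SCp, SSetRed), (SSetRed, SReply), (SReply, SIdle)} \<and>
            log_pos t i = log_pos s i"
        by cases (auto simp: effect_defs)
      then show ?thesis
        using marking_left_le[OF r, of i] True unfolding * marking_rank_def[of s i]
        by (auto simp: take_Suc_conv_app_nth)
    next
      case False
      have "marking_rank s i \<le> marking_rank t i"
        using step_sender_step[OF st, of i] marking_left_le[OF r, of i] unfolding * marking_rank_def[of s i]
        by cases (auto simp: take_Suc_conv_app_nth)
      with False show ?thesis by auto
    qed
  qed
  also have "\<dots> \<le> 4 * count_list (take (log_pos s i) (clog s i) @ drop (log_pos s i) (clog s i)) CpLog"
    unfolding marking_rank_def count_list_append by simp
  also have "\<dots> \<le> 4 * (nrep Sys + 2)"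
    using cplog_count[OF init_reachable[OF assms], of i] by simp
  finally show ?thesis .
qed

lemma finitely_many_added_steps:
  fixes Sys :: "('tx, 'obj, 'val) system"
  shows "finitely_many_added_steps Sys"
  unfolding finitely_many_added_steps_def
\<comment> \<open>The summand \<open>4 * (nrep Sys + 2)\<close> bounds the marking steps and, being
  at least 8, also the 3 sending and 5 receiving steps.\<close>
proof (intro exI[of _ "calc_const Sys + 4 * (nrep Sys + 2)"] allI impI, elim conjE)
  fix as :: "('tx, 'obj, 'val) action list" and s and w :: "'tx work"
  assume run: "run Sys (init_state Sys) as s" and w: "w \<noteq> Checkpointing"
  show "added_steps w as \<le> (calc_const Sys + 4 * (nrep Sys + 2)) * work_size Sys w"
  proof (cases w)
    case (Executing i T)
    then show ?thesis
      using executing_added[OF run, of i T] by (simp add: add_mult_distrib)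
  next
    case (Sending i T)
    then show ?thesis using sending_added[OF run, of i T] by simp
  next
    case (Receiving i j T)
    then show ?thesis using receiving_added[OF run, of i j T] by simp
  next
    case (Marking i)
    then show ?thesis using marking_added[OF run, of i] by simp
  qed (use w in simp)
qed

section \<open>Absence of waiting\<close>

lemma added_steps_never_wait:
  fixes Sys :: "('tx, 'obj, 'val) system"
  shows "added_steps_never_wait Sys"
proof -
  have "\<exists>a. added w a \<and> enabled Sys s a" if "at_added_step s w" for s :: "('tx, 'obj, 'val) state" and w
  proof (cases w)
    case (Sending i T)
    with that consider "spc s i = SRead T" | "spc s i = SAppend T" | "spc s i = SColor T" by auto
    then show ?thesis
    proof cases
      case 1 from step.read_color[OF 1] show ?thesis unfolding enabled_def
        by (intro exI[of _ "ReadColor i T"]) (auto simp: Sending)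
    next
      case 2 from step.sender_append[OF 2] show ?thesis unfolding enabled_def
        by (intro exI[of _ "SenderAppend i T"]) (auto simp: Sending)
    next
      case 3 from step.color_message[OF 3] show ?thesis unfolding enabled_def
        by (intro exI[of _ "ColorMessage i T"]) (auto simp: Sending)
    qed
  next
    case (Receiving i j T)
    with that obtain c where "rpc s (i, j) = RTest1 T c \<or> rpc s (i, j) = RCas T c \<or> rpc s (i, j) = RTest2 T c \<or>
      rpc s (i, j) = RAppend T c \<or> rpc s (i, j) = RCkpt T c \<or> rpc s (i, j) = RCount T c" by auto
    then have "enabled Sys s (Test1 i j T) \<or> enabled Sys s (Cas i j T) \<or> enabled Sys s (Test2 i j T) \<or>
      enabled Sys s (ReceiverAppend i j T) \<or> enabled Sys s (ExecOnCheckpoint i j T) \<or> enabled Sys s (Count i j T)"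
      unfolding enabled_def using step.test1 step.cas step.test2 step.receiver_append step.exec_on_checkpoint step.count
      by metis
    then show ?thesis
      using Receiving by (elim disjE) (rule exI, rule conjI[rotated], assumption, simp)+
  next
    case (Marking i)
    with that have "enabled Sys s (TestRed i) \<or> enabled Sys s (SetRed i) \<or> enabled Sys s (SendReply i)"
      unfolding enabled_def using step.test_red[of s i Sys] step.set_red[of s i Sys] step.send_reply[of s i Sys] by auto
    then show ?thesis
      using Marking by (elim disjE) (rule exI, rule conjI[rotated], assumption, simp)+
  qed (use that in auto)
  then show ?thesis unfolding added_steps_never_wait_def by blast
qed

lemma executions_not_blocked:
  fixes Sys :: "('tx, 'obj, 'val) system"
  shows "executions_not_blocked Sys"
  unfolding executions_not_blocked_def
proof (intro allI impI, elim conjE)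
  fix s :: "('tx, 'obj, 'val) state" and i and T :: 'tx
  assume "executing s i T"
  then consider "T \<in> client s i" | j c where "rpc s (i, j) = RExec T c"
    unfolding executing_def by blast
  then show "\<exists>a t. database_step a \<and> step Sys s a t \<and> T \<in> committed_at t i"
  proof cases
    case 1
    show ?thesis
      by (rule exI[of _ "CommitLocal i T"], rule exI, intro conjI, simp, rule step.commit_local[OF 1])
        (simp add: commit_def committed_at_def)
  next
    case (2 j c)
    show ?thesis
      by (rule exI[of _ "CommitRemote i j T"], rule exI, intro conjI, simp, rule step.commit_remote[OF 2])
        (simp add: commit_def committed_at_def)
  qed
qed

text \<open>The vacuous conjunct prevents the eta-contraction that would hide \<open>step\<close> from \<open>step.simps\<close>.\<close>

lemma enabled_conj_True: "enabled Sys s a \<longleftrightarrow> (\<exists>t. step Sys s a t \<and> True)"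
  by (simp add: enabled_def)

text \<open>The guards of these actions read only components on which the two states agree; RColor
  affects the successor state, never whether a step is possible.\<close>

lemma independent_of_checkpointing:
  fixes Sys :: "('tx, 'obj, 'val) system"
  shows "independent_of_checkpointing Sys"
proof -
  have "enabled Sys s a \<longleftrightarrow> enabled Sys s' a"
    if "checkpointing_variant s s'" "work_of a \<noteq> Checkpointing" for s s' :: "('tx, 'obj, 'val) state" and a
  proof -
    have "executing s' = executing s \<and> client s' = client s \<and> issued s' = issued s \<and> rpc s' = rpc s \<and>
        spc s' = spc s \<and> clog s' = clog s \<and> log_pos s' = log_pos s \<and> chan s' = chan s \<and>
        calc_used s' = calc_used s"
      using that(1) by (auto simp: checkpointing_variant_def executing_def fun_eq_iff)
    then show ?thesis
      using that(2) unfolding enabled_conj_True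
      by (cases a) (((simp only: step.simps, simp))[1])+
  qed
  then show ?thesis unfolding independent_of_checkpointing_def by blast
qed

theorem mainTheorem1:
  fixes Sys :: "('tx, 'obj::finite, 'val) system"
  assumes "replicated_database Sys"
  shows
    "(\<forall>before s0 s1 after s.
        run Sys (init_state Sys) before s0 \<and> step Sys s0 Invoke s1 \<and> run Sys s1 after s \<longrightarrow>
          (finished s \<longrightarrow>
             DTCS Sys s \<and>
             committed_at s0 1 \<subseteq> cp_set s \<and>
             (\<forall>x. copies s x = 1)) \<and>
          (\<forall>x. copies s x \<le> 1) \<and>
          control_messages (before @ [Invoke] @ after) \<le> 2 * nrep Sys - 2) \<and>
     asynchronous Sys"
proof (intro conjI allI impI; (elim conjE)?)
  fix before s0 s1 after s
  assume run0: "run Sys (init_state Sys) before s0" and inv: "step Sys s0 Invoke s1"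
    and run1: "run Sys s1 after s"
  have "run Sys (init_state Sys) (before @ [Invoke]) s1"
    using run0 inv by (rule run_snoc)
  then have run: "run Sys (init_state Sys) (before @ [Invoke] @ after) s"
    using run_append[OF run1] by fastforce
  have r: "reachable Sys s"
    using run by (rule init_reachable)
  show "control_messages (before @ [Invoke] @ after) \<le> 2 * nrep Sys - 2"
    using control_messages_le[OF run] assms by (simp add: replicated_database_def)
  show "copies s x \<le> 1" for x
    by (rule copies_le[OF r])
  assume fin: "finished s"
  show "DTCS Sys s"
    unfolding DTCS_def
    using finished_dirty_write_exclusion[OF assms r fin] finished_dependency_closure[OF r fin] by blast
  show "copies s x = 1" for x
    by (rule finished_copies[OF r fin])
  \<comment> \<open>Invocation only turns R1 Yellow, so the switch that fixes the cut lies in the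
    run after \<open>s1\<close>.\<close>
  have "\<not> red1 s1 \<and> committed_at s0 1 \<subseteq> committed_at s1 1"
    using inv by cases (auto simp: red1_def committed_at_def)
  then show "committed_at s0 1 \<subseteq> cp_set s"
    using recency_run[OF run1] fin by (auto simp: finished_def red1_def cp_set_def)
next
  show "asynchronous Sys"
    unfolding asynchronous_def
    using finitely_many_added_steps added_steps_never_wait executions_not_blocked
      independent_of_checkpointing by blast
qed

end
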